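(* Let $\nabla$ be a regular, locally metric connection on $M$ with $\operatorname{rank}\widetilde{W}=1$, and let $[\Phi]\in H^1_{deR}(M)$ be the associated de Rham cohomology class. Then $\nabla$ is a metric connection on $M$ if and only if $[\Phi]=0$ in $H^1_{deR}(M)$.
   Context: $M$ is a connected smooth manifold; connections and sections are smooth. A connection $\nabla$ on $M$ means a connection on $TM$, not necessarily symmetric. $\pi:W\to M$ is the vector bundle of symmetric elements of $T^*M\otimes T^*M$, with the induced connection, also denoted $\nabla$; $W_x=\pi^{-1}(x)$, and $R:TM\otimes TM\otimes W\to W$ is the curvature tensor of $\nabla$ on $W$. A metric is a positive-definite (Riemannian) metric; it is parallel if $\nabla g=0$. $\nabla$ is metric if there is a parallel metric on all of $M$; $\nabla$ is locally metric if every point of $M$ has a neighbourhood $U$ carrying a metric parallel with respect to $\nabla|_U$. Properties of a subset $W'\subseteq W$: (P1) for each $x\in M$, $W'_x:=W_x\cap W'$ is a linear subspace of $W_x$; (P2) for each $w\in W'$ there are an open neighbourhood $U$ of $\pi(w)$ and a smooth local section $X:U\to W$ with values in $W'$ such that $X(\pi(w))=w$. For $W'$ satisfying P1 and P2, the second fundamental 1-form $\alpha_{W'}:W'\to(W/W')\otimes T^*M$ (quotient taken fibrewise) is the fibrewise linear map sending $w\in W'$ to the class of $(\nabla X)(\pi(w))$ in $(W_{\pi(w)}/W'_{\pi(w)})\otimes T^*_{\pi(w)}M$, where $X$ is a local section with values in $W'$ and $X(\pi(w))=w$. For $V\subseteq W$ satisfying P1, $\mathcal{S}(V)$ is the set of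 $v\in V$ for which there is a smooth local section $X$ of $W$ near $\pi(v)$ with values in $V$ and $X(\pi(v))=v$. Derived flag: $V^{(0)}=\{w\in W: R(\cdot,\cdot)(w)=0\}$, $W^{(i)}=\mathcal{S}(V^{(i)})$, $V^{(i+1)}=\ker\alpha_{W^{(i)}}=\{w\in W^{(i)}:\alpha_{W^{(i)}}(w)=0\}$. The decreasing sequence $W\supseteq W^{(0)}\supseteq W^{(1)}\supseteq\cdots$ stabilizes: for some $k$, $W^{(l)}=W^{(k)}$ for all $l\ge k$. Define $\widetilde{W}=W^{(k)}$. $\nabla$ is regular if $\widetilde{W}$ is a vector bundle over $M$ (a subbundle of $W$); the dimension of its fibres is then denoted $\operatorname{rank}\widetilde{W}$. Definition of $[\Phi]$ (for $\nabla$ regular, locally metric, $\operatorname{rank}\widetilde{W}=1$): let $\widetilde{W}^+\subseteq\widetilde{W}$ be the subset of positive-definite bilinear forms, a fibre bundle over $M$, and let $s:M\to\widetilde{W}^+$ be any smooth section (a metric on $M$, not necessarily parallel). There is a unique 1-form $\Phi$ on $M$ with $\nabla s=s\otimes\Phi$; it is closed, and its class $[\Phi]\in H^1_{deR}(M)$ does not depend on the choice of $s$. *)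

theory Defs
  imports "HOL-Analysis.Analysis" "HOL-Library.Function_Algebras"
begin

text \<open>Pointwise scalar multiplication, so that spaces of tangent vectors and of bilinear forms are
  linear subspaces of function types and \<^const>\<open>subspace\<close>, \<^const>\<open>span\<close>, \<^const>\<open>dim\<close> apply.\<close>

instantiation "fun" :: (type, real_vector) real_vector
begin

definition scaleR_fun :: "real \<Rightarrow> ('a \<Rightarrow> 'b) \<Rightarrow> 'a \<Rightarrow> 'b"
  where "scaleR_fun c f = (\<lambda>x. c *\<^sub>R f x)"

instance
  by standard (auto simp: scaleR_fun_def fun_eq_iff algebra_simps)

end


subsection \<open>Smooth manifolds\<close>

text \<open>\<open>C\<^sup>k\<close> maps on an open subset \<open>S\<close> of a Euclidean space: all directional derivatives of a
  differentiable map are required to be \<open>C\<^sup>k\<^sup>-\<^sup>1\<close>.\<close>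

primrec Ck_on :: "nat \<Rightarrow> 'e::euclidean_space set \<Rightarrow> ('e \<Rightarrow> 'f::real_normed_vector) \<Rightarrow> bool" where
  "Ck_on 0 S f \<longleftrightarrow> continuous_on S f"
| "Ck_on (Suc k) S f \<longleftrightarrow> (\<forall>x\<in>S. f differentiable (at x)) \<and>
     (\<forall>u. Ck_on k S (\<lambda>x. frechet_derivative f (at x) u))"

definition smooth_on :: "'e::euclidean_space set \<Rightarrow> ('e \<Rightarrow> 'f::real_normed_vector) \<Rightarrow> bool"
  where "smooth_on S f \<longleftrightarrow> (\<forall>k. Ck_on k S f)"

text \<open>A chart is its domain together with its coordinate map; the coordinate map is irrelevant
  outside the domain.\<close>

type_synonym ('m, 'e) chart = "'m set \<times> ('m \<Rightarrow> 'e)"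

definition is_chart :: "('m::topological_space, 'e::euclidean_space) chart \<Rightarrow> bool"
  where "is_chart = (\<lambda>(U, \<phi>). open U \<and> open (\<phi> ` U) \<and> homeomorphism U (\<phi> ` U) \<phi> (inv_into U \<phi>))"

definition smoothly_compatible ::
    "('m::topological_space, 'e::euclidean_space) chart \<Rightarrow> ('m, 'e) chart \<Rightarrow> bool"
  where "smoothly_compatible = (\<lambda>(U, \<phi>) (V, \<psi>). smooth_on (\<phi> ` (U \<inter> V)) (\<psi> \<circ> inv_into U \<phi>))"

text \<open>The manifold is the whole type \<open>'m\<close>. Hausdorffness and second countability are part of its
  sort. The atlas \<open>A\<close> need not be maximal.\<close>

definition connected_smooth_manifold ::
    "('m::{t2_space, second_countable_topology}, 'e::euclidean_space) chart set \<Rightarrow> bool"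
  where "connected_smooth_manifold A \<longleftrightarrow>
    connected (UNIV :: 'm set) \<and>
    (\<forall>c\<in>A. is_chart c) \<and> (\<Union>c\<in>A. fst c) = UNIV \<and>
    (\<forall>c\<in>A. \<forall>d\<in>A. smoothly_compatible c d)"

definition smooth_fun ::
    "('m::topological_space, 'e::euclidean_space) chart set \<Rightarrow> 'm set \<Rightarrow> ('m \<Rightarrow> real) \<Rightarrow> bool"
  where "smooth_fun A U f \<longleftrightarrow> (\<forall>(V, \<phi>)\<in>A. smooth_on (\<phi> ` (U \<inter> V)) (f \<circ> inv_into V \<phi>))"

definition smooth_near ::
    "('m::topological_space, 'e::euclidean_space) chart set \<Rightarrow> 'm \<Rightarrow> ('m \<Rightarrow> real) \<Rightarrow> bool"
  where "smooth_near A p f \<longleftrightarrow> (\<exists>U. open U \<and> p \<in> U \<and> smooth_fun A U f)"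


subsection \<open>Tangent vectors and vector fields\<close>

text \<open>A tangent vector at \<open>p\<close> is the operator \<open>\<Sum>\<^sub>i u\<^sub>i \<partial>/\<partial>x\<^sub>i\<close> at \<open>p\<close> for the coordinates \<open>x\<close> of some
  chart, acting on functions that are smooth near \<open>p\<close>. Giving all other functions the value 0 makes
  the operator independent of the chart used to write it down.\<close>

type_synonym 'm tvec = "('m \<Rightarrow> real) \<Rightarrow> real"
type_synonym 'm vfield = "'m \<Rightarrow> 'm tvec"

definition coord_vec ::
    "('m::topological_space, 'e::euclidean_space) chart set \<Rightarrow> ('m, 'e) chart \<Rightarrow> 'm \<Rightarrow> 'e \<Rightarrow> 'm tvec"
  where "coord_vec A c p u = (\<lambda>f. if smooth_near A p f
    then frechet_derivative (f \<circ> inv_into (fst c) (snd c)) (at (snd c p)) u else 0)"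

definition tangent_space ::
    "('m::topological_space, 'e::euclidean_space) chart set \<Rightarrow> 'm \<Rightarrow> 'm tvec set"
  where "tangent_space A p = {coord_vec A c p u | c u. c \<in> A \<and> p \<in> fst c}"

text \<open>Sections over \<open>U\<close> are total functions whose values outside \<open>U\<close> are irrelevant.\<close>

definition vector_field ::
    "('m::topological_space, 'e::euclidean_space) chart set \<Rightarrow> 'm set \<Rightarrow> 'm vfield \<Rightarrow> bool"
  where "vector_field A U X \<longleftrightarrow>
    (\<forall>p\<in>U. X p \<in> tangent_space A p) \<and>
    (\<forall>V f. open V \<longrightarrow> V \<subseteq> U \<longrightarrow> smooth_fun A V f \<longrightarrow> smooth_fun A V (\<lambda>p. X p f))"

definition vector_field_near ::
    "('m::topological_space, 'e::euclidean_space) chart set \<Rightarrow> 'm \<Rightarrow> 'm vfield \<Rightarrow> bool"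
  where "vector_field_near A p X \<longleftrightarrow> (\<exists>U. open U \<and> p \<in> U \<and> vector_field A U X)"

definition lie_bracket ::
    "('m::topological_space, 'e::euclidean_space) chart set \<Rightarrow> 'm vfield \<Rightarrow> 'm vfield \<Rightarrow> 'm vfield"
  where "lie_bracket A X Y p = (\<lambda>f. if smooth_near A p f
    then X p (\<lambda>q. Y q f) - Y p (\<lambda>q. X q f) else 0)"


subsection \<open>Connections on the tangent bundle\<close>

text \<open>\<open>N p v Y\<close> is \<open>\<nabla>\<^sub>v Y\<close> for \<open>v \<in> T\<^sub>pM\<close> and a vector field \<open>Y\<close> that is smooth near \<open>p\<close>. No symmetry
  (vanishing of the torsion) is required.\<close>

type_synonym 'm covariant_derivative = "'m \<Rightarrow> 'm tvec \<Rightarrow> 'm vfield \<Rightarrow> 'm tvec"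

definition is_connection ::
    "('m::topological_space, 'e::euclidean_space) chart set \<Rightarrow> 'm covariant_derivative \<Rightarrow> bool"
  where "is_connection A N \<longleftrightarrow>
    (\<forall>p Y. \<forall>v\<in>tangent_space A p. vector_field_near A p Y \<longrightarrow> N p v Y \<in> tangent_space A p) \<and>
    (\<forall>p Y. \<forall>v\<in>tangent_space A p. \<forall>w\<in>tangent_space A p. vector_field_near A p Y \<longrightarrow>
       (\<forall>a b. N p (a *\<^sub>R v + b *\<^sub>R w) Y = a *\<^sub>R N p v Y + b *\<^sub>R N p w Y)) \<and>
    (\<forall>p Y Z. \<forall>v\<in>tangent_space A p. vector_field_near A p Y \<longrightarrow> vector_field_near A p Z \<longrightarrow>
       N p v (\<lambda>q. Y q + Z q) = N p v Y + N p v Z) \<and>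
    (\<forall>p f Y. \<forall>v\<in>tangent_space A p. smooth_near A p f \<longrightarrow> vector_field_near A p Y \<longrightarrow>
       N p v (\<lambda>q. f q *\<^sub>R Y q) = v f *\<^sub>R Y p + f p *\<^sub>R N p v Y) \<and>
    (\<forall>U p Y Z. \<forall>v\<in>tangent_space A p. open U \<longrightarrow> p \<in> U \<longrightarrow> vector_field A U Y \<longrightarrow>
       (\<forall>q\<in>U. Y q = Z q) \<longrightarrow> N p v Y = N p v Z) \<and>
    (\<forall>U X Y. open U \<longrightarrow> vector_field A U X \<longrightarrow> vector_field A U Y \<longrightarrow>
       vector_field A U (\<lambda>p. N p (X p) Y))"


subsection \<open>The bundle of symmetric bilinear forms\<close>

text \<open>Forms vanish outside \<open>T\<^sub>pM \<times> T\<^sub>pM\<close>, so that each form on \<open>T\<^sub>pM\<close> has a unique representative.\<close>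

type_synonym 'm form = "'m tvec \<Rightarrow> 'm tvec \<Rightarrow> real"

definition sym_forms ::
    "('m::topological_space, 'e::euclidean_space) chart set \<Rightarrow> 'm \<Rightarrow> 'm form set"
  where "sym_forms A p = {B.
    (\<forall>u v. B u v = B v u) \<and>
    (\<forall>u v. \<not> (u \<in> tangent_space A p \<and> v \<in> tangent_space A p) \<longrightarrow> B u v = 0) \<and>
    (\<forall>u\<in>tangent_space A p. \<forall>v\<in>tangent_space A p. \<forall>w\<in>tangent_space A p. \<forall>a b.
       B (a *\<^sub>R u + b *\<^sub>R v) w = a * B u w + b * B v w)}"

definition W_bundle ::
    "('m::topological_space, 'e::euclidean_space) chart set \<Rightarrow> ('m \<times> 'm form) set"
  where "W_bundle A = {(p, w). w \<in> sym_forms A p}"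

definition fibre :: "('m \<times> 'f) set \<Rightarrow> 'm \<Rightarrow> 'f set"
  where "fibre V p = {w. (p, w) \<in> V}"

definition W_section ::
    "('m::topological_space, 'e::euclidean_space) chart set \<Rightarrow> 'm set \<Rightarrow> ('m \<Rightarrow> 'm form) \<Rightarrow> bool"
  where "W_section A U h \<longleftrightarrow>
    (\<forall>p\<in>U. h p \<in> sym_forms A p) \<and>
    (\<forall>V X Y. open V \<longrightarrow> V \<subseteq> U \<longrightarrow> vector_field A V X \<longrightarrow> vector_field A V Y \<longrightarrow>
       smooth_fun A V (\<lambda>p. h p (X p) (Y p)))"

text \<open>The induced connection: \<open>\<nabla>\<^sub>v h\<close> is determined by the product rule
  \<open>v (h(Y, Z)) = (\<nabla>\<^sub>v h)(Y, Z) + h(\<nabla>\<^sub>v Y, Z) + h(Y, \<nabla>\<^sub>v Z)\<close>.\<close>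

definition nabla_W ::
    "('m::topological_space, 'e::euclidean_space) chart set \<Rightarrow> 'm covariant_derivative \<Rightarrow>
     'm \<Rightarrow> 'm tvec \<Rightarrow> ('m \<Rightarrow> 'm form) \<Rightarrow> 'm form"
  where "nabla_W A N p v h = (THE B. B \<in> sym_forms A p \<and>
    (\<forall>Y Z. vector_field_near A p Y \<longrightarrow> vector_field_near A p Z \<longrightarrow>
       v (\<lambda>q. h q (Y q) (Z q)) = B (Y p) (Z p) + h p (N p v Y) (Z p) + h p (Y p) (N p v Z)))"

definition curvature_on_fields ::
    "('m::topological_space, 'e::euclidean_space) chart set \<Rightarrow> 'm covariant_derivative \<Rightarrow>
     'm vfield \<Rightarrow> 'm vfield \<Rightarrow> ('m \<Rightarrow> 'm form) \<Rightarrow> 'm \<Rightarrow> 'm form"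
  where "curvature_on_fields A N X Y h p =
    nabla_W A N p (X p) (\<lambda>q. nabla_W A N q (Y q) h) -
    nabla_W A N p (Y p) (\<lambda>q. nabla_W A N q (X q) h) -
    nabla_W A N p (lie_bracket A X Y p) h"

definition curvature_tensor ::
    "('m::topological_space, 'e::euclidean_space) chart set \<Rightarrow> 'm covariant_derivative \<Rightarrow>
     'm \<Rightarrow> 'm tvec \<Rightarrow> 'm tvec \<Rightarrow> 'm form \<Rightarrow> 'm form"
  where "curvature_tensor A N p a b w = (THE B. \<exists>U X Y h. open U \<and> p \<in> U \<and>
    vector_field A U X \<and> vector_field A U Y \<and> W_section A U h \<and>
    X p = a \<and> Y p = b \<and> h p = w \<and> B = curvature_on_fields A N X Y h p)"


subsection \<open>Metrics\<close>

definition pos_def ::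
    "('m::topological_space, 'e::euclidean_space) chart set \<Rightarrow> 'm \<Rightarrow> 'm form \<Rightarrow> bool"
  where "pos_def A p B \<longleftrightarrow> (\<forall>v\<in>tangent_space A p. v \<noteq> 0 \<longrightarrow> B v v > 0)"

definition metric_on ::
    "('m::topological_space, 'e::euclidean_space) chart set \<Rightarrow> 'm set \<Rightarrow> ('m \<Rightarrow> 'm form) \<Rightarrow> bool"
  where "metric_on A U g \<longleftrightarrow> W_section A U g \<and> (\<forall>p\<in>U. pos_def A p (g p))"

definition parallel_on ::
    "('m::topological_space, 'e::euclidean_space) chart set \<Rightarrow> 'm covariant_derivative \<Rightarrow>
     'm set \<Rightarrow> ('m \<Rightarrow> 'm form) \<Rightarrow> bool"
  where "parallel_on A N U g \<longleftrightarrow> (\<forall>p\<in>U. \<forall>v\<in>tangent_space A p. nabla_W A N p v g = 0)"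

definition metric_connection ::
    "('m::topological_space, 'e::euclidean_space) chart set \<Rightarrow> 'm covariant_derivative \<Rightarrow> bool"
  where "metric_connection A N \<longleftrightarrow> (\<exists>g. metric_on A UNIV g \<and> parallel_on A N UNIV g)"

definition locally_metric ::
    "('m::topological_space, 'e::euclidean_space) chart set \<Rightarrow> 'm covariant_derivative \<Rightarrow> bool"
  where "locally_metric A N \<longleftrightarrow>
    (\<forall>p. \<exists>U g. open U \<and> p \<in> U \<and> metric_on A U g \<and> parallel_on A N U g)"


subsection \<open>The derived flag\<close>

definition section_part ::
    "('m::topological_space, 'e::euclidean_space) chart set \<Rightarrow> ('m \<times> 'm form) set \<Rightarrow> ('m \<times> 'm form) set"
  where "section_part A V = {(p, w). (p, w) \<in> V \<and>
    (\<exists>U X. open U \<and> p \<in> U \<and> W_section A U X \<and> (\<forall>q\<in>U. (q, X q) \<in> V) \<and> X p = w)}"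

text \<open>The second fundamental 1-form, as the relation between \<open>w \<in> W'\<^sub>p\<close> and its values. An element of
  \<open>(W\<^sub>p/W'\<^sub>p) \<otimes> T\<^sub>p\<^sup>*M\<close> is a map from \<open>T\<^sub>pM\<close> to cosets of \<open>W'\<^sub>p\<close>. Near points where \<open>W'\<close> is a vector
  bundle the value does not depend on the section \<open>X\<close>; at points where the rank of \<open>W'\<close> jumps it may,
  and then \<open>w\<close> counts as an element of the kernel if some \<open>X\<close> gives the value 0. In this way the kernel
  is always fibrewise a linear subspace.\<close>

definition second_fundamental_form ::
    "('m::topological_space, 'e::euclidean_space) chart set \<Rightarrow> 'm covariant_derivative \<Rightarrow>
     ('m \<times> 'm form) set \<Rightarrow> 'm \<Rightarrow> 'm form \<Rightarrow> ('m tvec \<Rightarrow> 'm form set) \<Rightarrow> bool"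
  where "second_fundamental_form A N W' p w \<alpha> \<longleftrightarrow>
    (\<exists>U X. open U \<and> p \<in> U \<and> W_section A U X \<and> (\<forall>q\<in>U. (q, X q) \<in> W') \<and> X p = w \<and>
       \<alpha> = (\<lambda>v\<in>tangent_space A p. (\<lambda>B. nabla_W A N p v X + B) ` fibre W' p))"

definition ker_second_fundamental_form ::
    "('m::topological_space, 'e::euclidean_space) chart set \<Rightarrow> 'm covariant_derivative \<Rightarrow>
     ('m \<times> 'm form) set \<Rightarrow> ('m \<times> 'm form) set"
  where "ker_second_fundamental_form A N W' = {(p, w). (p, w) \<in> W' \<and>
    second_fundamental_form A N W' p w (\<lambda>v\<in>tangent_space A p. fibre W' p)}"

primrec V_flag ::
    "('m::topological_space, 'e::euclidean_space) chart set \<Rightarrow> 'm covariant_derivative \<Rightarrow>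
     nat \<Rightarrow> ('m \<times> 'm form) set" where
  "V_flag A N 0 = {(p, w). (p, w) \<in> W_bundle A \<and>
     (\<forall>a\<in>tangent_space A p. \<forall>b\<in>tangent_space A p. curvature_tensor A N p a b w = 0)}"
| "V_flag A N (Suc i) = ker_second_fundamental_form A N (section_part A (V_flag A N i))"

definition W_flag ::
    "('m::topological_space, 'e::euclidean_space) chart set \<Rightarrow> 'm covariant_derivative \<Rightarrow>
     nat \<Rightarrow> ('m \<times> 'm form) set"
  where "W_flag A N i = section_part A (V_flag A N i)"

definition W_tilde ::
    "('m::topological_space, 'e::euclidean_space) chart set \<Rightarrow> 'm covariant_derivative \<Rightarrow>
     ('m \<times> 'm form) set"
  where "W_tilde A N = W_flag A N (LEAST k. \<forall>l\<ge>k. W_flag A N l = W_flag A N k)"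

definition vector_subbundle ::
    "('m::topological_space, 'e::euclidean_space) chart set \<Rightarrow> ('m \<times> 'm form) set \<Rightarrow> bool"
  where "vector_subbundle A V \<longleftrightarrow> V \<subseteq> W_bundle A \<and> (\<forall>p. subspace (fibre V p)) \<and>
    (\<forall>p. \<exists>U r e. open U \<and> p \<in> U \<and> (\<forall>i<r. W_section A U (e i)) \<and>
       (\<forall>q\<in>U. inj_on (\<lambda>i. e i q) {..<(r::nat)} \<and> independent ((\<lambda>i. e i q) ` {..<r}) \<and>
          span ((\<lambda>i. e i q) ` {..<r}) = fibre V q))"

definition bundle_rank :: "('m \<times> 'f::real_vector) set \<Rightarrow> nat"
  where "bundle_rank V = (THE r. \<forall>p. dim (fibre V p) = r)"

definition regular_connection ::
    "('m::topological_space, 'e::euclidean_space) chart set \<Rightarrow> 'm covariant_derivative \<Rightarrow> bool"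
  where "regular_connection A N \<longleftrightarrow> vector_subbundle A (W_tilde A N)"


subsection \<open>First de Rham cohomology\<close>

type_synonym 'm one_form = "'m \<Rightarrow> 'm tvec \<Rightarrow> real"

definition is_one_form ::
    "('m::topological_space, 'e::euclidean_space) chart set \<Rightarrow> 'm one_form \<Rightarrow> bool"
  where "is_one_form A \<Phi> \<longleftrightarrow>
    (\<forall>p v. v \<notin> tangent_space A p \<longrightarrow> \<Phi> p v = 0) \<and>
    (\<forall>p. \<forall>u\<in>tangent_space A p. \<forall>v\<in>tangent_space A p. \<forall>a b.
       \<Phi> p (a *\<^sub>R u + b *\<^sub>R v) = a * \<Phi> p u + b * \<Phi> p v) \<and>
    (\<forall>V X. open V \<longrightarrow> vector_field A V X \<longrightarrow> smooth_fun A V (\<lambda>p. \<Phi> p (X p)))"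

text \<open>\<open>d\<Phi>(X, Y) = X(\<Phi>(Y)) - Y(\<Phi>(X)) - \<Phi>([X, Y])\<close>\<close>

definition closed_one_form ::
    "('m::topological_space, 'e::euclidean_space) chart set \<Rightarrow> 'm one_form \<Rightarrow> bool"
  where "closed_one_form A \<Phi> \<longleftrightarrow> is_one_form A \<Phi> \<and>
    (\<forall>U X Y. open U \<longrightarrow> vector_field A U X \<longrightarrow> vector_field A U Y \<longrightarrow>
       (\<forall>p\<in>U. X p (\<lambda>q. \<Phi> q (Y q)) - Y p (\<lambda>q. \<Phi> q (X q)) - \<Phi> p (lie_bracket A X Y p) = 0))"

definition exact_one_form ::
    "('m::topological_space, 'e::euclidean_space) chart set \<Rightarrow> 'm one_form \<Rightarrow> bool"
  where "exact_one_form A \<Phi> \<longleftrightarrow> is_one_form A \<Phi> \<and>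
    (\<exists>f. smooth_fun A UNIV f \<and> (\<forall>p. \<forall>v\<in>tangent_space A p. \<Phi> p v = v f))"

definition cohomologous ::
    "('m::topological_space, 'e::euclidean_space) chart set \<Rightarrow> ('m one_form \<times> 'm one_form) set"
  where "cohomologous A = {(\<Phi>, \<Psi>). closed_one_form A \<Phi> \<and> closed_one_form A \<Psi> \<and>
    exact_one_form A (\<Phi> - \<Psi>)}"

text \<open>\<open>H\<^sup>1\<^sub>d\<^sub>e\<^sub>R(M)\<close> is the quotient of the closed 1-forms by \<^const>\<open>cohomologous\<close>; its elements are
  equivalence classes.\<close>

definition de_rham_class ::
    "('m::topological_space, 'e::euclidean_space) chart set \<Rightarrow> 'm one_form \<Rightarrow> 'm one_form set"
  where "de_rham_class A \<Phi> = cohomologous A `` {\<Phi>}"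


subsection \<open>The class of a connection\<close>

definition W_tilde_pos ::
    "('m::topological_space, 'e::euclidean_space) chart set \<Rightarrow> 'm covariant_derivative \<Rightarrow>
     ('m \<times> 'm form) set"
  where "W_tilde_pos A N = {(p, w). (p, w) \<in> W_tilde A N \<and> pos_def A p w}"

text \<open>The class of the 1-form with \<open>\<nabla>s = s \<otimes> \<Phi>\<close> is the same for all sections \<open>s\<close>; as usual for
  choice-independent maps into a quotient, it is written as the union over all choices.\<close>

definition connection_class ::
    "('m::topological_space, 'e::euclidean_space) chart set \<Rightarrow> 'm covariant_derivative \<Rightarrow>
     'm one_form set"
  where "connection_class A N = (\<Union>(s, \<Phi>)\<in>{(s, \<Phi>).
      W_section A UNIV s \<and> (\<forall>p. (p, s p) \<in> W_tilde_pos A N) \<and>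
      is_one_form A \<Phi> \<and>
      (\<forall>p. \<forall>v\<in>tangent_space A p. nabla_W A N p v s = \<Phi> p v *\<^sub>R s p)}.
    de_rham_class A \<Phi>)"

end

theory Submission
  imports Defs
begin

text \<open>
  Write a positive-definite section of \<open>W_tilde\<close> as \<open>s\<close>, with \<open>\<nabla>s = \<Phi> \<otimes> s\<close>. For a positive function
  \<open>a\<close>, the product rule gives \<open>\<nabla>(a s) = (d (ln a) + \<Phi>) \<otimes> a s\<close>. So rescaling \<open>s\<close> changes \<open>\<Phi>\<close> by an exact
  form, and \<open>s\<close> can be rescaled to a parallel metric iff \<open>\<Phi>\<close> itself is exact.

  If the class is that of \<open>0\<close>, it is inhabited (by \<open>0\<close>), so some \<open>s\<close> with \<open>\<Phi> = df\<close> exists, and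
  \<open>exp (- f) s\<close> is a parallel metric (\<open>parallel_rescaling\<close>).

  If conversely \<open>g\<close> is a parallel metric, then \<open>g\<close> takes values in \<open>W_tilde\<close> (\<open>parallel_in_W_tilde\<close>).
  The fibres are lines, so every positive section is \<open>s = c g\<close> with \<open>c > 0\<close>, and its 1-form is
  \<open>\<Phi> = d (ln c)\<close> (\<open>exact_of_parallel_multiple\<close>). Hence every pair \<open>(s, \<Phi>)\<close> represents the class of \<open>0\<close>,
  and the pair \<open>(g, 0)\<close> shows that there is at least one.

  Most of the work is to show that the objects given by definite descriptions are what they should be. The
  induced connection \<open>nabla_W\<close> satisfies the product rule because the value prescribed for
  \<open>(\<nabla>\<^sub>v h)(Y, Z)\<close> is linear over functions in \<open>Y\<close> and \<open>Z\<close>, hence depends on their values at the point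
  only (\<open>tensorial\<close>). The curvature tensor vanishes on a parallel \<open>g\<close> because
  \<open>(R(X, Y) h)(Z, T) = - h(R(X, Y) Z, T) - h(Z, R(X, Y) T)\<close> shows that it may be computed with the
  parallel extension \<open>g\<close> (\<open>curvature_on_fields_apply\<close>). That formula involves \<open>\<nabla>\<close> in the direction
  \<open>[X, Y]\<close>, so one needs that \<open>[X, Y]\<close> is a tangent vector (\<open>lie_bracket_tangent\<close>), which rests on the
  symmetry of second derivatives.
\<close>

section \<open>Differentiable functions on open subsets of a Euclidean space\<close>

lemma frechet_derivative_cong_open:
  assumes "open S" "x \<in> S" "\<And>y. y \<in> S \<Longrightarrow> f y = g y"
  shows "frechet_derivative f (at x) = frechet_derivative g (at x)"
proof -
  have "(f has_derivative D) (at x) \<longleftrightarrow> (g has_derivative D) (at x)" for D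
    using has_derivative_transform_within_open[where f=f and g=g, OF _ assms(1,2)]
      has_derivative_transform_within_open[where f=g and g=f, OF _ assms(1,2)] assms(3) by auto
  then show ?thesis by (simp add: frechet_derivative_def)
qed

lemma differentiable_cong_open:
  assumes "open S" "x \<in> S" "\<And>y. y \<in> S \<Longrightarrow> f y = g y" "f differentiable (at x)"
  shows "g differentiable (at x)"
  using assms(4) has_derivative_transform_within_open[where f=f and g=g, OF _ assms(1-3)]
  unfolding differentiable_def by blast

lemma Ck_on_cong:
  assumes "open S" "\<And>x. x \<in> S \<Longrightarrow> f x = g x" "Ck_on k S f"
  shows "Ck_on k S g"
  using assms(2,3)
proof (induction k arbitrary: f g)
  case 0
  then show ?case using continuous_on_eq by force
next
  case (Suc k)
  have "g differentiable (at x)" if "x \<in> S" for x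
    using differentiable_cong_open[OF assms(1) that, of f g] Suc.prems that by auto
  moreover have "Ck_on k S (\<lambda>x. frechet_derivative g (at x) u)" for u
    using Suc.IH[of "\<lambda>x. frechet_derivative f (at x) u"] Suc.prems
      frechet_derivative_cong_open[OF assms(1), of _ f g] by auto
  ultimately show ?case by simp
qed

lemma Ck_on_subset:
  assumes "Ck_on k S f" "T \<subseteq> S"
  shows "Ck_on k T f"
  using assms by (induction k arbitrary: f) (auto intro: continuous_on_subset)

lemma Ck_on_continuous:
  assumes "Ck_on k S f"
  shows "continuous_on S f"
proof (cases k)
  case 0
  then show ?thesis using assms by simp
next
  case (Suc j)
  then show ?thesis
    using assms by (intro continuous_at_imp_continuous_on ballI differentiable_imp_continuous_within) auto
qed

lemma Ck_on_SucD:
  assumes "Ck_on (Suc k) S f"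
  shows "Ck_on k S f"
  using assms
proof (induction k arbitrary: f)
  case 0
  show ?case using Ck_on_continuous[OF 0] by simp
next
  case (Suc k)
  then show ?case by auto
qed

lemma Ck_on_local:
  assumes "\<And>x. x \<in> S \<Longrightarrow> \<exists>T. open T \<and> x \<in> T \<and> Ck_on k T f"
  shows "Ck_on k S f"
  using assms
proof (induction k arbitrary: f)
  case 0
  have "continuous (at x) f" if "x \<in> S" for x
    using 0[OF that] continuous_on_eq_continuous_at by auto
  then show ?case by (simp add: continuous_at_imp_continuous_on)
next
  case (Suc k)
  have "f differentiable (at x)" if "x \<in> S" for x using Suc.prems[OF that] by auto
  moreover have "Ck_on k S (\<lambda>x. frechet_derivative f (at x) u)" for u
    by (rule Suc.IH) (use Suc.prems in force)
  ultimately show ?case by simp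
qed

lemma Ck_on_const: "Ck_on k S (\<lambda>x. c)"
  by (induction k arbitrary: c) simp_all

lemma Ck_on_add:
  assumes "open S" "Ck_on k S f" "Ck_on k S g"
  shows "Ck_on k S (\<lambda>x. f x + g x)"
  using assms(2,3)
proof (induction k arbitrary: f g)
  case 0
  then show ?case by (simp add: continuous_on_add)
next
  case (Suc k)
  let ?D = "\<lambda>h x. frechet_derivative h (at x)"
  have D: "((\<lambda>x. f x + g x) has_derivative (\<lambda>u. ?D f x u + ?D g x u)) (at x)" if "x \<in> S" for x
    using Suc.prems that
    by (intro has_derivative_add) (simp_all flip: frechet_derivative_works)
  have "Ck_on k S (\<lambda>x. ?D (\<lambda>x. f x + g x) x u)" for u
  proof (rule Ck_on_cong[OF assms(1)])
    show "Ck_on k S (\<lambda>x. ?D f x u + ?D g x u)"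
      using Suc.prems by (intro Suc.IH) simp_all
    show "?D f x u + ?D g x u = ?D (\<lambda>x. f x + g x) x u" if "x \<in> S" for x
      using frechet_derivative_at[OF D[OF that]] by metis
  qed
  moreover have "(\<lambda>x. f x + g x) differentiable (at x)" if "x \<in> S" for x
    using D[OF that] by (auto simp: differentiable_def)
  ultimately show ?case by simp
qed

lemma Ck_on_mult:
  fixes f g :: "'a::euclidean_space \<Rightarrow> real"
  assumes "open S" "Ck_on k S f" "Ck_on k S g"
  shows "Ck_on k S (\<lambda>x. f x * g x)"
  using assms(2,3)
proof (induction k arbitrary: f g)
  case 0
  then show ?case by (simp add: continuous_on_mult)
next
  case (Suc k)
  let ?D = "\<lambda>h x. frechet_derivative h (at x)"
  have D: "((\<lambda>x. f x * g x) has_derivative (\<lambda>u. f x * ?D g x u + ?D f x u * g x)) (at x)"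
    if "x \<in> S" for x
    using Suc.prems that
    by (intro has_derivative_mult) (simp_all flip: frechet_derivative_works)
  have "Ck_on k S (\<lambda>x. ?D (\<lambda>x. f x * g x) x u)" for u
  proof (rule Ck_on_cong[OF assms(1)])
    show "Ck_on k S (\<lambda>x. f x * ?D g x u + ?D f x u * g x)"
      using Suc.prems Ck_on_SucD[OF Suc.prems(1)] Ck_on_SucD[OF Suc.prems(2)]
      by (intro Ck_on_add[OF assms(1)] Suc.IH) simp_all
    show "f x * ?D g x u + ?D f x u * g x = ?D (\<lambda>x. f x * g x) x u" if "x \<in> S" for x
      using frechet_derivative_at[OF D[OF that]] by metis
  qed
  moreover have "(\<lambda>x. f x * g x) differentiable (at x)" if "x \<in> S" for x
    using D[OF that] by (auto simp: differentiable_def)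
  ultimately show ?case by simp
qed

lemma Ck_on_sum:
  assumes "open S" "\<And>i. i \<in> I \<Longrightarrow> Ck_on k S (f i)"
  shows "Ck_on k S (\<lambda>x. \<Sum>i\<in>I. f i x)"
  using assms(2) by (induction I rule: infinite_finite_induct) (auto intro: Ck_on_const Ck_on_add[OF assms(1)])

text \<open>Post-composition with \<open>x \<mapsto> x \<bullet> i\<close> is the case that gives coordinate components.\<close>

lemma Ck_on_bounded_linear:
  assumes "open S" "bounded_linear L" "Ck_on k S f"
  shows "Ck_on k S (\<lambda>x. L (f x))"
  using assms(3)
proof (induction k arbitrary: f)
  case 0
  then show ?case using bounded_linear.continuous_on[OF assms(2)] by simp
next
  case (Suc k)
  have D: "((\<lambda>x. L (f x)) has_derivative (\<lambda>u. L (frechet_derivative f (at x) u))) (at x)" if "x \<in> S" for x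
    using Suc.prems that
    by (intro bounded_linear.has_derivative[OF assms(2)]) (simp flip: frechet_derivative_works)
  have "Ck_on k S (\<lambda>x. frechet_derivative (\<lambda>x. L (f x)) (at x) u)" for u
  proof (rule Ck_on_cong[OF assms(1)])
    show "Ck_on k S (\<lambda>x. L (frechet_derivative f (at x) u))"
      using Suc.prems by (intro Suc.IH) simp
    show "L (frechet_derivative f (at x) u) = frechet_derivative (\<lambda>x. L (f x)) (at x) u" if "x \<in> S" for x
      using frechet_derivative_at[OF D[OF that]] by metis
  qed
  moreover have "(\<lambda>x. L (f x)) differentiable (at x)" if "x \<in> S" for x
    using D[OF that] by (auto simp: differentiable_def)
  ultimately show ?case by simp
qed

lemma Ck_on_ident: "Ck_on k S (\<lambda>x. x)"
  by (cases k) (auto intro: Ck_on_const)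

text \<open>The chain rule is written in coordinates of the intermediate space, so that the derivative of
  a composition is a finite sum of products of functions to which the induction hypothesis applies.\<close>

lemma Ck_on_compose:
  fixes f :: "'b::euclidean_space \<Rightarrow> real" and g :: "'a::euclidean_space \<Rightarrow> 'b"
  assumes "open S" "open T" "g ` S \<subseteq> T" "Ck_on k S g" "Ck_on k T f"
  shows "Ck_on k S (\<lambda>x. f (g x))"
  using assms(4,5)
proof (induction k arbitrary: f)
  case 0
  then show ?case using continuous_on_compose2 assms(3) by auto
next
  case (Suc k)
  let ?D = "\<lambda>h x. frechet_derivative h (at x)"
  have D: "((\<lambda>x. f (g x)) has_derivative (\<lambda>u. ?D f (g x) (?D g x u))) (at x)" if "x \<in> S" for x
  proof -
    have "(g has_derivative ?D g x) (at x)"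
      using Suc.prems that by (simp flip: frechet_derivative_works)
    moreover have "(f has_derivative ?D f (g x)) (at (g x))"
      using Suc.prems that assms(3) by (auto simp flip: frechet_derivative_works)
    ultimately show ?thesis by (rule has_derivative_compose)
  qed
  have "Ck_on k S (\<lambda>x. ?D (\<lambda>x. f (g x)) x u)" for u
  proof (rule Ck_on_cong[OF assms(1)])
    show "Ck_on k S (\<lambda>x. \<Sum>i\<in>Basis. (?D g x u \<bullet> i) * ?D f (g x) i)"
      using Suc.prems Ck_on_SucD[OF Suc.prems(1)]
      by (intro Ck_on_sum Ck_on_mult assms Suc.IH Ck_on_bounded_linear[of S "\<lambda>x. x \<bullet> _"])
         (auto intro: bounded_linear_inner_left)
    fix x assume x: "x \<in> S"
    then have lin: "linear (?D f (g x))"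
      using Suc.prems assms(3) by (intro linear_frechet_derivative) auto
    have "?D f (g x) (?D g x u) = ?D f (g x) (\<Sum>i\<in>Basis. (?D g x u \<bullet> i) *\<^sub>R i)"
      by (simp add: euclidean_representation)
    also have "\<dots> = (\<Sum>i\<in>Basis. (?D g x u \<bullet> i) * ?D f (g x) i)"
      using lin by (simp add: linear_sum linear_cmul del: euclidean_representation)
    finally show "(\<Sum>i\<in>Basis. (?D g x u \<bullet> i) * ?D f (g x) i) = ?D (\<lambda>x. f (g x)) x u"
      using frechet_derivative_at[OF D[OF x]] by metis
  qed
  moreover have "(\<lambda>x. f (g x)) differentiable (at x)" if "x \<in> S" for x
    using D[OF that] by (auto simp: differentiable_def)
  ultimately show ?case by simp
qed

lemma frechet_derivative_real:
  assumes "(f has_real_derivative D) (at x)"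
  shows "frechet_derivative f (at x) u = D * u"
  using frechet_derivative_at[of f "(*) D" x] assms by (simp add: has_field_derivative_def)

lemma Ck_on_exp: "Ck_on k UNIV (exp :: real \<Rightarrow> real)"
proof (induction k)
  case 0
  then show ?case by (simp add: continuous_on_exp)
next
  case (Suc k)
  have "frechet_derivative exp (at x) u = exp x * u" for x u :: real
    by (intro frechet_derivative_real DERIV_exp)
  moreover have "(exp :: real \<Rightarrow> real) differentiable (at x)" for x
    using DERIV_exp by (auto simp: differentiable_def has_field_derivative_def)
  ultimately show ?case
    using Ck_on_mult[OF open_UNIV Suc Ck_on_const] by simp
qed

lemma Ck_on_inverse: "Ck_on k {0<..} (inverse :: real \<Rightarrow> real)"
proof (induction k)
  case 0
  then show ?case by (auto intro!: continuous_intros)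
next
  case (Suc k)
  have D: "(inverse has_real_derivative - (inverse x * inverse x)) (at x)" if "x > 0" for x :: real
    using DERIV_inverse[of x UNIV] that by (simp add: power2_eq_square)
  have "Ck_on k {0<..} (\<lambda>x. frechet_derivative inverse (at x) u)" for u :: real
  proof (rule Ck_on_cong)
    show "Ck_on k {0<..} (\<lambda>x::real. (inverse x * inverse x) * (- u))"
      by (rule Ck_on_mult[OF open_greaterThan Ck_on_mult[OF open_greaterThan Suc Suc] Ck_on_const])
  qed (simp_all add: frechet_derivative_real[OF D])
  then show ?case using D by (auto simp: differentiable_def has_field_derivative_def)
qed

lemma Ck_on_ln: "Ck_on k {0<..} (ln :: real \<Rightarrow> real)"
proof (cases k)
  case 0
  then show ?thesis by (auto intro!: continuous_intros)
next
  case (Suc j)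
  have D: "(ln has_real_derivative inverse x) (at x)" if "x > 0" for x :: real
    using that by (auto intro: DERIV_ln)
  have "Ck_on j {0<..} (\<lambda>x. frechet_derivative ln (at x) u)" for u :: real
  proof (rule Ck_on_cong)
    show "Ck_on j {0<..} (\<lambda>x::real. inverse x * u)"
      by (rule Ck_on_mult[OF open_greaterThan Ck_on_inverse Ck_on_const])
  qed (simp_all add: frechet_derivative_real[OF D])
  then show ?thesis using D Suc by (auto simp: differentiable_def has_field_derivative_def)
qed

lemma smooth_on_exp: "smooth_on UNIV (exp :: real \<Rightarrow> real)"
  and smooth_on_ln: "smooth_on {0<..} (ln :: real \<Rightarrow> real)"
  by (simp_all add: smooth_on_def Ck_on_exp Ck_on_ln)

lemma smooth_on_differentiable: "smooth_on S f \<Longrightarrow> x \<in> S \<Longrightarrow> f differentiable (at x)"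
  unfolding smooth_on_def by (metis Ck_on.simps(2))

lemma smooth_on_frechet_derivative:
  "smooth_on S f \<Longrightarrow> smooth_on S (\<lambda>x. frechet_derivative f (at x) u)"
  unfolding smooth_on_def by (metis Ck_on.simps(2))

lemma smooth_on_subset: "smooth_on S f \<Longrightarrow> T \<subseteq> S \<Longrightarrow> smooth_on T f"
  unfolding smooth_on_def by (metis Ck_on_subset)

lemma smooth_on_cong: "open S \<Longrightarrow> (\<And>x. x \<in> S \<Longrightarrow> f x = g x) \<Longrightarrow> smooth_on S f \<Longrightarrow> smooth_on S g"
  unfolding smooth_on_def by (metis Ck_on_cong)

lemma smooth_on_compose:
  fixes f :: "'b::euclidean_space \<Rightarrow> real" and g :: "'a::euclidean_space \<Rightarrow> 'b"
  shows "open S \<Longrightarrow> open T \<Longrightarrow> g ` S \<subseteq> T \<Longrightarrow> smooth_on S g \<Longrightarrow> smooth_on T f \<Longrightarrow> smooth_on S (\<lambda>x. f (g x))"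
  unfolding smooth_on_def by (metis Ck_on_compose)

lemma smooth_on_add: "open S \<Longrightarrow> smooth_on S f \<Longrightarrow> smooth_on S g \<Longrightarrow> smooth_on S (\<lambda>x. f x + g x)"
  by (simp add: smooth_on_def Ck_on_add)

lemma smooth_on_mult:
  fixes f g :: "'a::euclidean_space \<Rightarrow> real"
  shows "open S \<Longrightarrow> smooth_on S f \<Longrightarrow> smooth_on S g \<Longrightarrow> smooth_on S (\<lambda>x. f x * g x)"
  by (simp add: smooth_on_def Ck_on_mult)

lemma has_derivative_line:
  fixes F :: "'a::euclidean_space \<Rightarrow> real"
  assumes "F differentiable (at (a + s *\<^sub>R u))"
  shows "((\<lambda>s. F (a + s *\<^sub>R u)) has_real_derivative frechet_derivative F (at (a + s *\<^sub>R u)) u) (at s)"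
proof -
  let ?D = "frechet_derivative F (at (a + s *\<^sub>R u))"
  have "((\<lambda>s. F (a + s *\<^sub>R u)) has_derivative (\<lambda>h. ?D (h *\<^sub>R u))) (at s)"
  proof -
    have "((\<lambda>s. a + s *\<^sub>R u) has_derivative (\<lambda>h. h *\<^sub>R u)) (at s)"
      by (auto intro!: derivative_eq_intros)
    moreover have "(F has_derivative ?D) (at (a + s *\<^sub>R u))"
      using assms by (simp flip: frechet_derivative_works)
    ultimately show ?thesis by (rule has_derivative_compose)
  qed
  moreover have "?D (h *\<^sub>R u) = ?D u * h" for h
    using linear_frechet_derivative[OF assms] by (simp add: linear_cmul)
  ultimately show ?thesis by (simp add: has_field_derivative_def fun_eq_iff)
qed

text \<open>The second difference of \<open>f\<close> over a small parallelogram is symmetric in its two sides, and two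
  applications of the mean value theorem express it by a mixed second derivative nearby.\<close>

lemma second_difference_mean_value:
  fixes f :: "'a::euclidean_space \<Rightarrow> real"
  assumes f: "Ck_on 2 (ball x r) f" and \<delta>: "\<delta> > 0" "\<delta> * (norm u + norm v) < r"
  obtains y where "dist x y \<le> \<delta> * (norm u + norm v)"
    and "f (x + \<delta> *\<^sub>R u + \<delta> *\<^sub>R v) - f (x + \<delta> *\<^sub>R u) - f (x + \<delta> *\<^sub>R v) + f x =
      \<delta> * \<delta> * frechet_derivative (\<lambda>y. frechet_derivative f (at y) u) (at y) v"
proof -
  let ?D = "\<lambda>h x. frechet_derivative h (at x)"
  have near: "dist x (x + s *\<^sub>R u + t *\<^sub>R v) \<le> \<delta> * (norm u + norm v)"
    if "0 \<le> s" "s \<le> \<delta>" "0 \<le> t" "t \<le> \<delta>" for s t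
  proof -
    have "dist x (x + s *\<^sub>R u + t *\<^sub>R v) = norm (s *\<^sub>R u + t *\<^sub>R v)"
      unfolding add.assoc by (simp only: dist_norm norm_minus_commute[of x] add_diff_cancel_left')
    also have "\<dots> \<le> s * norm u + t * norm v"
      using that by (metis abs_of_nonneg norm_scaleR norm_triangle_ineq)
    also have "\<dots> \<le> \<delta> * norm u + \<delta> * norm v" using that by (intro add_mono mult_right_mono) auto
    finally show ?thesis by (simp add: algebra_simps)
  qed
  then have inb: "x + s *\<^sub>R u + t *\<^sub>R v \<in> ball x r"
    if "0 \<le> s" "s \<le> \<delta>" "0 \<le> t" "t \<le> \<delta>" for s t using that \<delta> by fastforce
  have d1: "f differentiable (at y)" if "y \<in> ball x r" for y
    using f that by (simp add: numeral_2_eq_2)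
  have d2: "(\<lambda>y. ?D f y u) differentiable (at y)" if "y \<in> ball x r" for y
    using f that by (simp add: numeral_2_eq_2)
  \<comment> \<open>First the mean value theorem in the direction \<open>u\<close>, then in the direction \<open>v\<close>.\<close>
  define \<phi> where "\<phi> = (\<lambda>s. f (x + \<delta> *\<^sub>R v + s *\<^sub>R u) - f (x + s *\<^sub>R u))"
  have "\<exists>s. 0 < s \<and> s < \<delta> \<and>
      \<phi> \<delta> - \<phi> 0 = (\<delta> - 0) * (?D f (x + \<delta> *\<^sub>R v + s *\<^sub>R u) u - ?D f (x + s *\<^sub>R u) u)"
    unfolding \<phi>_def
    using \<delta> inb[of _ \<delta>] inb[of _ 0]
    by (intro MVT2 DERIV_diff has_derivative_line d1) (auto simp: algebra_simps)
  then obtain s where s: "0 < s" "s < \<delta>"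
    "\<phi> \<delta> - \<phi> 0 = \<delta> * (?D f (x + s *\<^sub>R u + \<delta> *\<^sub>R v) u - ?D f (x + s *\<^sub>R u + 0 *\<^sub>R v) u)"
    by (auto simp: algebra_simps)
  have "\<exists>t. 0 < t \<and> t < \<delta> \<and>
      ?D f (x + s *\<^sub>R u + \<delta> *\<^sub>R v) u - ?D f (x + s *\<^sub>R u + 0 *\<^sub>R v) u =
      (\<delta> - 0) * ?D (\<lambda>y. ?D f y u) (x + s *\<^sub>R u + t *\<^sub>R v) v"
    using \<delta> inb[of s] s by (intro MVT2 has_derivative_line d2) auto
  then obtain t where t: "0 < t" "t < \<delta>"
      "?D f (x + s *\<^sub>R u + \<delta> *\<^sub>R v) u - ?D f (x + s *\<^sub>R u + 0 *\<^sub>R v) u =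
      \<delta> * ?D (\<lambda>y. ?D f y u) (x + s *\<^sub>R u + t *\<^sub>R v) v" by auto
  show thesis
  proof (rule that)
    show "dist x (x + s *\<^sub>R u + t *\<^sub>R v) \<le> \<delta> * (norm u + norm v)" using near s t by simp
    show "f (x + \<delta> *\<^sub>R u + \<delta> *\<^sub>R v) - f (x + \<delta> *\<^sub>R u) - f (x + \<delta> *\<^sub>R v) + f x =
        \<delta> * \<delta> * ?D (\<lambda>y. ?D f y u) (x + s *\<^sub>R u + t *\<^sub>R v) v"
      using s(3) t(3) by (simp add: \<phi>_def algebra_simps)
  qed
qed

text \<open>Both mixed derivatives at \<open>x\<close> are limits of the same second difference quotient.\<close>

theorem second_derivative_symmetric:
  fixes f :: "'a::euclidean_space \<Rightarrow> real"
  assumes "open S" "x \<in> S" "Ck_on 2 S f"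
  shows "frechet_derivative (\<lambda>y. frechet_derivative f (at y) u) (at x) v =
    frechet_derivative (\<lambda>y. frechet_derivative f (at y) v) (at x) u"
proof -
  define D2 where "D2 = (\<lambda>u v y. frechet_derivative (\<lambda>y. frechet_derivative f (at y) u) (at y) v)"
  obtain r where r: "r > 0" "ball x r \<subseteq> S" using assms openE by blast
  have f: "Ck_on 2 (ball x r) f" using assms r Ck_on_subset by blast
  then have cont: "continuous_on (ball x r) (D2 u v)" for u v
    by (simp add: numeral_2_eq_2 D2_def)
  have le: "\<bar>D2 u v x - D2 v u x\<bar> \<le> 2 * \<epsilon>" if "\<epsilon> > 0" for \<epsilon>
  proof -
    have "\<exists>d>0. \<forall>y. dist x y < d \<longrightarrow> \<bar>D2 a b y - D2 a b x\<bar> < \<epsilon>" for a b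
    proof -
      have "isCont (D2 a b) x"
        using cont[of a b] r(1) by (simp add: continuous_on_eq_continuous_at)
      then show ?thesis
        using that unfolding continuous_at_eps_delta dist_real_def by (metis dist_commute)
    qed
    then obtain d e where d: "d > 0" "\<And>y. dist x y < d \<Longrightarrow> \<bar>D2 u v y - D2 u v x\<bar> < \<epsilon>"
      and e: "e > 0" "\<And>y. dist x y < e \<Longrightarrow> \<bar>D2 v u y - D2 v u x\<bar> < \<epsilon>" by metis
    \<comment> \<open>The step is so small that the whole parallelogram lies in all three balls.\<close>
    let ?m = "min r (min d e)" and ?n = "norm u + norm v"
    define \<delta> where "\<delta> = ?m / (?n + 1)"
    have pos: "?n + 1 > 0" by (simp add: add_nonneg_pos)
    have \<delta>: "\<delta> > 0" using r d e pos by (simp add: \<delta>_def)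
    have "\<delta> * ?n < \<delta> * (?n + 1)" using \<delta> by simp
    also have "\<dots> = ?m" using pos by (simp add: \<delta>_def)
    finally have le: "\<delta> * ?n < r" "\<delta> * ?n < d" "\<delta> * ?n < e" by auto
    obtain y where y: "dist x y \<le> \<delta> * ?n"
      "f (x + \<delta> *\<^sub>R u + \<delta> *\<^sub>R v) - f (x + \<delta> *\<^sub>R u) - f (x + \<delta> *\<^sub>R v) + f x = \<delta> * \<delta> * D2 u v y"
      using second_difference_mean_value[OF f \<delta> le(1)] unfolding D2_def by blast
    obtain z where z: "dist x z \<le> \<delta> * ?n"
      "f (x + \<delta> *\<^sub>R v + \<delta> *\<^sub>R u) - f (x + \<delta> *\<^sub>R v) - f (x + \<delta> *\<^sub>R u) + f x = \<delta> * \<delta> * D2 v u z"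
      using second_difference_mean_value[OF f \<delta>, of v u] le unfolding D2_def by (auto simp: add.commute)
    have "\<delta> * \<delta> * D2 u v y = \<delta> * \<delta> * D2 v u z"
      using y(2) z(2) by (simp add: algebra_simps)
    then have "D2 u v y = D2 v u z" using \<delta> by simp
    moreover have "\<bar>D2 u v y - D2 u v x\<bar> < \<epsilon>" "\<bar>D2 v u z - D2 v u x\<bar> < \<epsilon>"
      using d e y z le by force+
    ultimately show ?thesis by linarith
  qed
  have "\<bar>D2 u v x - D2 v u x\<bar> \<le> 0"
  proof (rule field_le_epsilon)
    show "\<bar>D2 u v x - D2 v u x\<bar> \<le> 0 + e" if "0 < e" for e
      using le[of "e / 2"] that by simp
  qed
  then show ?thesis by (simp add: D2_def)
qed

section \<open>Smooth functions and tangent vectors on a manifold\<close>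

abbreviation chart_inv :: "('m, 'e) chart \<Rightarrow> 'e \<Rightarrow> 'm"
  where "chart_inv c \<equiv> inv_into (fst c) (snd c)"

locale smooth_atlas =
  fixes A :: "('m::{t2_space, second_countable_topology}, 'e::euclidean_space) chart set"
  assumes manifold: "connected_smooth_manifold A"
begin

lemma chart_at:
  obtains c where "c \<in> A" "p \<in> fst c"
  using manifold unfolding connected_smooth_manifold_def by blast

lemma is_chart: "c \<in> A \<Longrightarrow> is_chart c"
  using manifold unfolding connected_smooth_manifold_def by blast

lemma open_chart: "c \<in> A \<Longrightarrow> open (fst c)"
  using is_chart unfolding is_chart_def by (auto simp: case_prod_beta)

lemma chart_inv:
  assumes "c \<in> A" "p \<in> fst c"
  shows "chart_inv c (snd c p) = p"
  using is_chart[OF assms(1)] assms(2) unfolding is_chart_def homeomorphism_def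
  by (auto simp: case_prod_beta)

lemma open_chart_image:
  assumes "c \<in> A" "open U"
  shows "open (snd c ` (U \<inter> fst c))"
proof -
  have c: "open (fst c)" "open (snd c ` fst c)"
      "homeomorphism (fst c) (snd c ` fst c) (snd c) (chart_inv c)"
    using is_chart[OF assms(1)] unfolding is_chart_def by (auto simp: case_prod_beta)
  have "openin (top_of_set (fst c)) (U \<inter> fst c)"
    using assms(2) c(1) by (simp add: openin_open_eq open_Int)
  then have "openin (top_of_set (snd c ` fst c)) (snd c ` (U \<inter> fst c))"
    by (rule homeomorphism_imp_open_map[OF c(3)])
  then show ?thesis using c(2) by (simp add: openin_open_eq)
qed

lemma transition_smooth:
  "c \<in> A \<Longrightarrow> d \<in> A \<Longrightarrow> smooth_on (snd c ` (fst c \<inter> fst d)) (snd d \<circ> chart_inv c)"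
  using manifold unfolding connected_smooth_manifold_def smoothly_compatible_def
  by (auto simp: case_prod_beta)

lemma smooth_fun_iff:
  "smooth_fun A U f \<longleftrightarrow> (\<forall>c\<in>A. smooth_on (snd c ` (U \<inter> fst c)) (f \<circ> chart_inv c))"
  unfolding smooth_fun_def by (auto simp: case_prod_beta)

lemma smooth_fun_subset: "smooth_fun A U f \<Longrightarrow> V \<subseteq> U \<Longrightarrow> smooth_fun A V f"
  unfolding smooth_fun_iff by (meson Int_mono image_mono order_refl smooth_on_subset)

lemma smooth_fun_cong:
  assumes "open U" "\<And>q. q \<in> U \<Longrightarrow> f q = g q" "smooth_fun A U f"
  shows "smooth_fun A U g"
  unfolding smooth_fun_iff
proof
  fix c assume c: "c \<in> A"
  show "smooth_on (snd c ` (U \<inter> fst c)) (g \<circ> chart_inv c)"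
  proof (rule smooth_on_cong[OF open_chart_image[OF c assms(1)]])
    show "smooth_on (snd c ` (U \<inter> fst c)) (f \<circ> chart_inv c)"
      using assms(3) c by (simp add: smooth_fun_iff)
  qed (use assms(2) chart_inv[OF c] in auto)
qed

lemma smooth_fun_local:
  assumes "\<And>p. p \<in> U \<Longrightarrow> \<exists>T. open T \<and> p \<in> T \<and> smooth_fun A T f"
  shows "smooth_fun A U f"
  unfolding smooth_fun_iff smooth_on_def
proof (intro ballI allI Ck_on_local)
  fix c k x assume c: "c \<in> A" and "x \<in> snd c ` (U \<inter> fst c)"
  then obtain p where p: "x = snd c p" "p \<in> U" "p \<in> fst c" by auto
  obtain T where T: "open T" "p \<in> T" "smooth_fun A T f" using assms p(2) by blast
  show "\<exists>S. open S \<and> x \<in> S \<and> Ck_on k S (f \<circ> chart_inv c)"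
  proof (intro exI conjI)
    show "open (snd c ` (T \<inter> fst c))" using open_chart_image c T(1) .
    show "Ck_on k (snd c ` (T \<inter> fst c)) (f \<circ> chart_inv c)"
      using T(3) c unfolding smooth_fun_iff smooth_on_def by blast
  qed (use p T in auto)
qed

text \<open>A function that is smooth in one chart is smooth in every other one, because transition maps are
  smooth.\<close>

lemma smooth_fun_in_chart:
  assumes c: "c \<in> A" and U: "open U" "U \<subseteq> fst c" and g: "smooth_on (snd c ` U) g"
  shows "smooth_fun A U (\<lambda>q. g (snd c q))"
  unfolding smooth_fun_iff
proof
  fix d assume d: "d \<in> A"
  let ?S = "snd d ` (U \<inter> fst d)"
  have "smooth_on ?S (\<lambda>x. g ((snd c \<circ> chart_inv d) x))"
  proof (rule smooth_on_compose[OF _ _ _ _ g])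
    show "open ?S" using open_chart_image d U by blast
    show "open (snd c ` U)" using open_chart_image[OF c U(1)] U(2) by (simp add: Int_absorb2)
    show "(snd c \<circ> chart_inv d) ` ?S \<subseteq> snd c ` U" using chart_inv[OF d] by auto
    show "smooth_on ?S (snd c \<circ> chart_inv d)"
      using transition_smooth[OF d c] by (rule smooth_on_subset) (use U in auto)
  qed
  then show "smooth_on ?S ((\<lambda>q. g (snd c q)) \<circ> chart_inv d)" by (simp add: o_def)
qed

lemma smooth_fun_const: "smooth_fun A U (\<lambda>q. a)"
  unfolding smooth_fun_iff smooth_on_def o_def using Ck_on_const by blast

lemma smooth_fun_add: "open U \<Longrightarrow> smooth_fun A U f \<Longrightarrow> smooth_fun A U g \<Longrightarrow> smooth_fun A U (\<lambda>q. f q + g q)"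
  unfolding smooth_fun_iff o_def using smooth_on_add[OF open_chart_image] by blast

lemma smooth_fun_mult: "open U \<Longrightarrow> smooth_fun A U f \<Longrightarrow> smooth_fun A U g \<Longrightarrow> smooth_fun A U (\<lambda>q. f q * g q)"
  unfolding smooth_fun_iff o_def using smooth_on_mult[OF open_chart_image] by blast

lemma smooth_fun_diff: "open U \<Longrightarrow> smooth_fun A U f \<Longrightarrow> smooth_fun A U g \<Longrightarrow> smooth_fun A U (\<lambda>q. f q - g q)"
  using smooth_fun_add[of U f "\<lambda>q. (- 1) * g q"] smooth_fun_mult[OF _ smooth_fun_const, of U g "- 1"] by simp

lemma smooth_fun_compose:
  fixes F :: "real \<Rightarrow> real"
  assumes "open U" "smooth_fun A U f" "smooth_on T F" "open T" "f ` U \<subseteq> T"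
  shows "smooth_fun A U (\<lambda>q. F (f q))"
  unfolding smooth_fun_iff
proof
  fix c assume c: "c \<in> A"
  have "smooth_on (snd c ` (U \<inter> fst c)) (\<lambda>x. F ((f \<circ> chart_inv c) x))"
  proof (rule smooth_on_compose[OF open_chart_image[OF c assms(1)] assms(4) _ _ assms(3)])
    show "(f \<circ> chart_inv c) ` (snd c ` (U \<inter> fst c)) \<subseteq> T" using assms(5) chart_inv[OF c] by auto
    show "smooth_on (snd c ` (U \<inter> fst c)) (f \<circ> chart_inv c)" using assms(2) c by (simp add: smooth_fun_iff)
  qed
  then show "smooth_on (snd c ` (U \<inter> fst c)) ((\<lambda>q. F (f q)) \<circ> chart_inv c)" by (simp add: o_def)
qed

lemma smooth_nearI: "open U \<Longrightarrow> p \<in> U \<Longrightarrow> smooth_fun A U f \<Longrightarrow> smooth_near A p f"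
  unfolding smooth_near_def by blast

lemma smooth_near_const: "smooth_near A p (\<lambda>q. a)"
  using smooth_nearI[OF open_UNIV UNIV_I smooth_fun_const] .

lemma smooth_near_common:
  assumes "smooth_near A p f" "smooth_near A p g"
  obtains U where "open U" "p \<in> U" "smooth_fun A U f" "smooth_fun A U g"
proof -
  obtain U V where "open U" "p \<in> U" "smooth_fun A U f" "open V" "p \<in> V" "smooth_fun A V g"
    using assms unfolding smooth_near_def by blast
  then have "open (U \<inter> V)" "p \<in> U \<inter> V" "smooth_fun A (U \<inter> V) f" "smooth_fun A (U \<inter> V) g"
    using smooth_fun_subset by auto
  then show thesis by (rule that)
qed

lemma smooth_near_add: "smooth_near A p f \<Longrightarrow> smooth_near A p g \<Longrightarrow> smooth_near A p (\<lambda>q. f q + g q)"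
  by (metis smooth_near_common smooth_nearI smooth_fun_add)

lemma smooth_near_mult: "smooth_near A p f \<Longrightarrow> smooth_near A p g \<Longrightarrow> smooth_near A p (\<lambda>q. f q * g q)"
  by (metis smooth_near_common smooth_nearI smooth_fun_mult)

lemma smooth_near_sum:
  "(\<And>i. i \<in> I \<Longrightarrow> smooth_near A p (f i)) \<Longrightarrow> smooth_near A p (\<lambda>q. \<Sum>i\<in>I. f i q)"
  by (induction I rule: infinite_finite_induct) (simp_all add: smooth_near_const smooth_near_add)

lemma smooth_near_cong:
  assumes "open U" "p \<in> U" "\<And>q. q \<in> U \<Longrightarrow> f q = g q" "smooth_near A p f"
  shows "smooth_near A p g"
proof -
  obtain V where V: "open V" "p \<in> V" "smooth_fun A V f" using assms(4) unfolding smooth_near_def by blast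
  have "smooth_fun A (U \<inter> V) g"
    using assms(1,3) V smooth_fun_subset[OF V(3)] by (intro smooth_fun_cong[of "U \<inter> V" f g]) auto
  then show ?thesis using assms V by (intro smooth_nearI[of "U \<inter> V"]) auto
qed

lemma smooth_near_in_chart:
  assumes "smooth_near A p f" "c \<in> A" "p \<in> fst c"
  obtains S where "open S" "snd c p \<in> S" "smooth_on S (f \<circ> chart_inv c)"
proof -
  obtain U where U: "open U" "p \<in> U" "smooth_fun A U f" using assms(1) unfolding smooth_near_def by blast
  show thesis
  proof (rule that)
    show "open (snd c ` (U \<inter> fst c))" using open_chart_image assms(2) U(1) .
    show "smooth_on (snd c ` (U \<inter> fst c)) (f \<circ> chart_inv c)" using U(3) assms(2) by (simp add: smooth_fun_iff)
  qed (use U assms in auto)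
qed

lemma smooth_near_differentiable:
  assumes "smooth_near A p f" "c \<in> A" "p \<in> fst c"
  shows "(f \<circ> chart_inv c) differentiable (at (snd c p))"
  using smooth_near_in_chart[OF assms] smooth_on_differentiable by metis

lemma coord_vec_apply:
  "smooth_near A p f \<Longrightarrow> coord_vec A c p u f = frechet_derivative (f \<circ> chart_inv c) (at (snd c p)) u"
  by (simp add: coord_vec_def)

lemma coord_vec_linear:
  assumes "c \<in> A" "p \<in> fst c"
  shows "linear (coord_vec A c p)"
proof (rule linearI)
  have lin: "linear (frechet_derivative (f \<circ> chart_inv c) (at (snd c p)))" if "smooth_near A p f" for f
    using smooth_near_differentiable[OF that assms] by (rule linear_frechet_derivative)
  show "coord_vec A c p (u + v) = coord_vec A c p u + coord_vec A c p v" for u v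
    using lin by (auto simp: coord_vec_def linear_add)
  show "coord_vec A c p (r *\<^sub>R u) = r *\<^sub>R coord_vec A c p u" for r u
    using lin by (auto simp: coord_vec_def linear_cmul scaleR_fun_def)
qed

text \<open>The chain rule for the transition map. It makes the tangent space computable in any one chart, and
  hence a linear space.\<close>

lemma coord_vec_change:
  assumes c: "c \<in> A" "p \<in> fst c" and d: "d \<in> A" "p \<in> fst d"
  shows "coord_vec A c p u =
    coord_vec A d p (frechet_derivative (snd d \<circ> chart_inv c) (at (snd c p)) u)"
proof
  fix f
  show "coord_vec A c p u f =
    coord_vec A d p (frechet_derivative (snd d \<circ> chart_inv c) (at (snd c p)) u) f"
  proof (cases "smooth_near A p f")
    case True
    let ?S = "snd c ` (fst d \<inter> fst c)" and ?t = "snd d \<circ> chart_inv c" and ?F = "f \<circ> chart_inv d"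
    have S: "open ?S" "snd c p \<in> ?S" using open_chart_image[OF c(1) open_chart[OF d(1)]] c d by auto
    have tp: "?t (snd c p) = snd d p" using chart_inv c by simp
    have "?t differentiable (at (snd c p))"
      using transition_smooth[OF c(1) d(1)] S(2) by (simp add: smooth_on_differentiable Int_commute)
    then have t: "(?t has_derivative frechet_derivative ?t (at (snd c p))) (at (snd c p))"
      using frechet_derivative_works by blast
    have "?F differentiable (at (?t (snd c p)))"
      using smooth_near_differentiable[OF True d] tp by simp
    then have F: "(?F has_derivative frechet_derivative ?F (at (?t (snd c p)))) (at (?t (snd c p)))"
      using frechet_derivative_works by blast
    have "(\<lambda>x. ?F (?t x)) x = (f \<circ> chart_inv c) x" if "x \<in> ?S" for x
      using that chart_inv c(1) d(1) by auto
    then have "frechet_derivative (f \<circ> chart_inv c) (at (snd c p)) =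
        frechet_derivative (\<lambda>x. ?F (?t x)) (at (snd c p))"
      using frechet_derivative_cong_open[OF S, of "\<lambda>x. ?F (?t x)" "f \<circ> chart_inv c"] by simp
    then show ?thesis
      using frechet_derivative_at[OF has_derivative_compose[OF t F]] True tp
      by (simp add: coord_vec_apply fun_eq_iff)
  qed (simp add: coord_vec_def)
qed

lemma tangent_space_eq:
  assumes "c \<in> A" "p \<in> fst c"
  shows "tangent_space A p = range (coord_vec A c p)"
proof
  show "tangent_space A p \<subseteq> range (coord_vec A c p)"
  proof
    fix v assume "v \<in> tangent_space A p"
    then obtain d u where "d \<in> A" "p \<in> fst d" "v = coord_vec A d p u"
      unfolding tangent_space_def by blast
    then show "v \<in> range (coord_vec A c p)" using coord_vec_change[OF _ _ assms] by simp
  qed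
qed (use assms in \<open>unfold tangent_space_def, blast\<close>)

lemma subspace_tangent_space: "subspace (tangent_space A p)"
proof -
  obtain c where c: "c \<in> A" "p \<in> fst c" by (rule chart_at)
  show ?thesis
    unfolding tangent_space_eq[OF c] by (rule linear_subspace_image[OF coord_vec_linear[OF c] subspace_UNIV])
qed

lemmas tangent_0 [simp] = subspace_0[OF subspace_tangent_space]
lemmas tangent_closed = subspace_add[OF subspace_tangent_space]
  subspace_diff[OF subspace_tangent_space]
  subspace_scale[OF subspace_tangent_space] subspace_sum[OF subspace_tangent_space]

lemma tangentE:
  assumes "v \<in> tangent_space A p"
  obtains c u where "c \<in> A" "p \<in> fst c" "v = coord_vec A c p u"
  using assms unfolding tangent_space_def by blast

lemma tangent_not_smooth:
  assumes "v \<in> tangent_space A p" "\<not> smooth_near A p f"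
  shows "v f = 0"
  using assms by (auto elim!: tangentE simp: coord_vec_def)

lemma tangent_cong:
  assumes v: "v \<in> tangent_space A p" and U: "open U" "p \<in> U" "\<And>q. q \<in> U \<Longrightarrow> f q = g q"
  shows "v f = v g"
proof (cases "smooth_near A p f")
  case f: True
  have g: "smooth_near A p g" using smooth_near_cong[OF U f] .
  obtain c u where c: "c \<in> A" "p \<in> fst c" "v = coord_vec A c p u" using v by (rule tangentE)
  have "frechet_derivative (f \<circ> chart_inv c) (at (snd c p)) = frechet_derivative (g \<circ> chart_inv c) (at (snd c p))"
    by (rule frechet_derivative_cong_open[OF open_chart_image[OF c(1) U(1)]])
       (use U c chart_inv in auto)
  then show ?thesis using f g c by (simp add: coord_vec_apply)
next
  case f: False
  have "\<not> smooth_near A p g" using smooth_near_cong[OF U(1,2), of g f] U(3) f by auto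
  then show ?thesis using f tangent_not_smooth[OF v] by simp
qed

lemma tangent_add:
  assumes "v \<in> tangent_space A p" and f: "smooth_near A p f" and g: "smooth_near A p g"
  shows "v (\<lambda>q. f q + g q) = v f + v g"
proof -
  obtain c u where c: "c \<in> A" "p \<in> fst c" "v = coord_vec A c p u" using assms(1) by (rule tangentE)
  have "((\<lambda>x. (f \<circ> chart_inv c) x + (g \<circ> chart_inv c) x) has_derivative
     (\<lambda>u. frechet_derivative (f \<circ> chart_inv c) (at (snd c p)) u +
       frechet_derivative (g \<circ> chart_inv c) (at (snd c p)) u)) (at (snd c p))"
    using smooth_near_differentiable[OF f c(1,2)] smooth_near_differentiable[OF g c(1,2)]
    unfolding frechet_derivative_works by (rule has_derivative_add)
  from frechet_derivative_at[OF this] show ?thesis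
    using f g c smooth_near_add[OF f g] by (simp add: coord_vec_apply o_def fun_eq_iff)
qed

lemma tangent_mult:
  assumes "v \<in> tangent_space A p" and f: "smooth_near A p f" and g: "smooth_near A p g"
  shows "v (\<lambda>q. f q * g q) = v f * g p + f p * v g"
proof -
  obtain c u where c: "c \<in> A" "p \<in> fst c" "v = coord_vec A c p u" using assms(1) by (rule tangentE)
  have "((\<lambda>x. (f \<circ> chart_inv c) x * (g \<circ> chart_inv c) x) has_derivative
     (\<lambda>u. (f \<circ> chart_inv c) (snd c p) * frechet_derivative (g \<circ> chart_inv c) (at (snd c p)) u +
       frechet_derivative (f \<circ> chart_inv c) (at (snd c p)) u * (g \<circ> chart_inv c) (snd c p))) (at (snd c p))"
    using smooth_near_differentiable[OF f c(1,2)] smooth_near_differentiable[OF g c(1,2)]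
    unfolding frechet_derivative_works by (rule has_derivative_mult)
  from frechet_derivative_at[OF this] show ?thesis
    using f g c smooth_near_mult[OF f g] chart_inv[OF c(1,2)]
    by (simp add: coord_vec_apply o_def fun_eq_iff add.commute)
qed

lemma tangent_const:
  assumes "v \<in> tangent_space A p"
  shows "v (\<lambda>q. a) = 0"
proof -
  obtain c u where c: "c \<in> A" "p \<in> fst c" "v = coord_vec A c p u" using assms by (rule tangentE)
  then show ?thesis using smooth_near_const by (simp add: coord_vec_apply o_def)
qed

lemma tangent_cmult:
  assumes "v \<in> tangent_space A p" and f: "smooth_near A p f"
  shows "v (\<lambda>q. a * f q) = a * v f"
  using tangent_mult[OF assms(1) smooth_near_const f] tangent_const[OF assms(1)] by simp

lemma tangent_diff:
  assumes "v \<in> tangent_space A p" and f: "smooth_near A p f" and g: "smooth_near A p g"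
  shows "v (\<lambda>q. f q - g q) = v f - v g"
  using tangent_add[OF assms(1) f smooth_near_mult[OF smooth_near_const g], of "- 1"]
    tangent_cmult[OF assms(1) g, of "- 1"] by simp

lemma tangent_sum:
  assumes v: "v \<in> tangent_space A p" and "\<And>i. i \<in> I \<Longrightarrow> smooth_near A p (f i)"
  shows "v (\<lambda>q. \<Sum>i\<in>I. f i q) = (\<Sum>i\<in>I. v (f i))"
  using assms(2)
  by (induction I rule: infinite_finite_induct)
     (simp_all add: tangent_const[OF v] tangent_add[OF v] smooth_near_sum)

lemma tangent_compose:
  assumes "v \<in> tangent_space A p" and f: "smooth_near A p f" and Ff: "smooth_near A p (\<lambda>q. F (f q))"
    and F: "(F has_real_derivative D) (at (f p))"
  shows "v (\<lambda>q. F (f q)) = D * v f"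
proof -
  obtain c u where c: "c \<in> A" "p \<in> fst c" "v = coord_vec A c p u" using assms(1) by (rule tangentE)
  have "((f \<circ> chart_inv c) has_derivative frechet_derivative (f \<circ> chart_inv c) (at (snd c p))) (at (snd c p))"
    using smooth_near_differentiable[OF f c(1,2)] frechet_derivative_works by blast
  moreover have "(F has_derivative (*) D) (at ((f \<circ> chart_inv c) (snd c p)))"
    using F chart_inv[OF c(1,2)] by (simp add: has_field_derivative_def)
  ultimately have "((\<lambda>x. F ((f \<circ> chart_inv c) x)) has_derivative
      (\<lambda>u. D * frechet_derivative (f \<circ> chart_inv c) (at (snd c p)) u)) (at (snd c p))"
    by (rule has_derivative_compose)
  from frechet_derivative_at[OF this] show ?thesis
    using f Ff c by (simp add: coord_vec_apply o_def fun_eq_iff)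
qed


section \<open>Vector fields and coordinate frames\<close>

abbreviation coord :: "('m, 'e) chart \<Rightarrow> 'e \<Rightarrow> 'm \<Rightarrow> real"
  where "coord c i \<equiv> (\<lambda>q. snd c q \<bullet> i)"

lemma smooth_coord:
  assumes "c \<in> A"
  shows "smooth_fun A (fst c) (coord c i)"
proof (rule smooth_fun_in_chart[OF assms open_chart[OF assms] order_refl])
  have "open (snd c ` fst c)" using open_chart_image[OF assms open_UNIV] by simp
  then show "smooth_on (snd c ` fst c) (\<lambda>x. x \<bullet> i)"
    unfolding smooth_on_def using Ck_on_bounded_linear[OF _ bounded_linear_inner_left Ck_on_ident] by blast
qed

lemma smooth_near_coord: "c \<in> A \<Longrightarrow> p \<in> fst c \<Longrightarrow> smooth_near A p (coord c i)"
  using smooth_nearI open_chart smooth_coord by blast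

lemma coord_vec_coord:
  assumes c: "c \<in> A" "p \<in> fst c"
  shows "coord_vec A c p u (coord c i) = u \<bullet> i"
proof -
  let ?S = "snd c ` fst c"
  have S: "open ?S" "snd c p \<in> ?S" using open_chart_image[OF c(1) open_UNIV] c by auto
  have "frechet_derivative (coord c i \<circ> chart_inv c) (at (snd c p)) = frechet_derivative (\<lambda>x. x \<bullet> i) (at (snd c p))"
    by (rule frechet_derivative_cong_open[OF S]) (use chart_inv[OF c(1)] in auto)
  also have "\<dots> = (\<lambda>x. x \<bullet> i)"
    by (rule frechet_derivative_at[symmetric])
       (rule bounded_linear_imp_has_derivative[OF bounded_linear_inner_left])
  finally show ?thesis using smooth_near_coord[OF c] by (simp add: coord_vec_apply)
qed

text \<open>The coefficient of the \<open>i\<close>-th frame vector is read off by applying \<open>v\<close> to the \<open>i\<close>-th coordinate.\<close>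

lemma tangent_expand:
  assumes c: "c \<in> A" "p \<in> fst c" and v: "v \<in> tangent_space A p"
  shows "v = (\<Sum>i\<in>Basis. v (coord c i) *\<^sub>R coord_vec A c p i)"
proof -
  obtain u where u: "v = coord_vec A c p u" using v tangent_space_eq[OF c] by auto
  have "coord_vec A c p u = coord_vec A c p (\<Sum>i\<in>Basis. (u \<bullet> i) *\<^sub>R i)"
    by (simp add: euclidean_representation)
  also have "\<dots> = (\<Sum>i\<in>Basis. (u \<bullet> i) *\<^sub>R coord_vec A c p i)"
    using coord_vec_linear[OF c] by (simp add: linear_sum linear_cmul del: euclidean_representation)
  finally show ?thesis unfolding u coord_vec_coord[OF c] .
qed

lemma coord_vec_tangent [intro]: "c \<in> A \<Longrightarrow> p \<in> fst c \<Longrightarrow> coord_vec A c p u \<in> tangent_space A p"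
  unfolding tangent_space_def by blast

lemma coord_vec_nonzero:
  assumes "c \<in> A" "p \<in> fst c" "i \<in> Basis"
  shows "coord_vec A c p i \<noteq> 0"
proof
  assume "coord_vec A c p i = 0"
  then show False using coord_vec_coord[OF assms(1,2), of i i] assms(3) by simp
qed

lemma coord_field:
  assumes "c \<in> A"
  shows "vector_field A (fst c) (\<lambda>q. coord_vec A c q u)"
  unfolding vector_field_def
proof (intro conjI ballI allI impI)
  fix V f assume V: "open V" "V \<subseteq> fst c" and f: "smooth_fun A V f"
  let ?g = "\<lambda>x. frechet_derivative (f \<circ> chart_inv c) (at x) u"
  have "smooth_on (snd c ` V) (f \<circ> chart_inv c)"
    using f assms V(2) unfolding smooth_fun_iff by (metis Int_absorb2)
  then have "smooth_fun A V (\<lambda>q. ?g (snd c q))"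
    by (intro smooth_fun_in_chart[OF assms V] smooth_on_frechet_derivative)
  then show "smooth_fun A V (\<lambda>q. coord_vec A c q u f)"
    by (rule smooth_fun_cong[OF V(1), rotated])
       (use smooth_nearI[OF V(1) _ f] in \<open>simp add: coord_vec_apply\<close>)
qed (use assms in blast)

lemma vector_field_subset: "vector_field A U X \<Longrightarrow> V \<subseteq> U \<Longrightarrow> vector_field A V X"
  unfolding vector_field_def by (meson subset_trans subsetD)

lemma vector_field_tangent: "vector_field A U X \<Longrightarrow> p \<in> U \<Longrightarrow> X p \<in> tangent_space A p"
  unfolding vector_field_def by blast

lemma vector_field_smooth:
  "vector_field A U X \<Longrightarrow> open V \<Longrightarrow> V \<subseteq> U \<Longrightarrow> smooth_fun A V f \<Longrightarrow> smooth_fun A V (\<lambda>p. X p f)"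
  unfolding vector_field_def by blast

lemma vector_field_zero: "vector_field A U (\<lambda>q. 0)"
  unfolding vector_field_def by (simp add: smooth_fun_const)

lemma vector_field_add:
  assumes "vector_field A U X" "vector_field A U Y"
  shows "vector_field A U (\<lambda>q. X q + Y q)"
  using assms unfolding vector_field_def by (simp add: tangent_closed smooth_fun_add)

lemma vector_field_scale:
  assumes "vector_field A U X" "smooth_fun A U a"
  shows "vector_field A U (\<lambda>q. a q *\<^sub>R X q)"
  unfolding vector_field_def
proof (intro conjI ballI allI impI)
  fix V f assume V: "open V" "V \<subseteq> U" "smooth_fun A V f"
  then have "smooth_fun A V (\<lambda>p. a p * X p f)"
    using smooth_fun_mult smooth_fun_subset[OF assms(2)] vector_field_smooth[OF assms(1)] by blast
  then show "smooth_fun A V (\<lambda>p. (a p *\<^sub>R X p) f)" by (simp add: scaleR_fun_def)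
qed (use vector_field_tangent[OF assms(1)] in \<open>simp add: tangent_closed\<close>)

lemma vector_field_nearI: "open U \<Longrightarrow> p \<in> U \<Longrightarrow> vector_field A U X \<Longrightarrow> vector_field_near A p X"
  unfolding vector_field_near_def by blast

lemma vector_field_near_common:
  assumes "vector_field_near A p X" "vector_field_near A p Y"
  obtains U where "open U" "p \<in> U" "vector_field A U X" "vector_field A U Y"
proof -
  obtain U V where "open U" "p \<in> U" "vector_field A U X" "open V" "p \<in> V" "vector_field A V Y"
    using assms unfolding vector_field_near_def by blast
  then have "open (U \<inter> V)" "p \<in> U \<inter> V" "vector_field A (U \<inter> V) X" "vector_field A (U \<inter> V) Y"
    using vector_field_subset by auto
  then show thesis by (rule that)
qed

lemma vector_field_near_tangent: "vector_field_near A p X \<Longrightarrow> X p \<in> tangent_space A p"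
  unfolding vector_field_near_def using vector_field_tangent by blast

lemma vector_field_near_add:
  assumes "vector_field_near A p X" "vector_field_near A p Y"
  shows "vector_field_near A p (\<lambda>q. X q + Y q)"
  using vector_field_near_common[OF assms] vector_field_add vector_field_nearI by metis

lemma vector_field_near_scale:
  assumes "vector_field_near A p X" "smooth_near A p a"
  shows "vector_field_near A p (\<lambda>q. a q *\<^sub>R X q)"
proof -
  obtain U V where "open U" "p \<in> U" "vector_field A U X" "open V" "p \<in> V" "smooth_fun A V a"
    using assms unfolding vector_field_near_def smooth_near_def by blast
  then show ?thesis
    by (intro vector_field_nearI[of "U \<inter> V"] vector_field_scale)
       (auto intro: vector_field_subset smooth_fun_subset)
qed

lemma vector_field_near_sum:
  assumes "\<And>i. i \<in> I \<Longrightarrow> vector_field_near A p (X i)"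
  shows "vector_field_near A p (\<lambda>q. \<Sum>i\<in>I. X i q)"
  using assms vector_field_nearI[OF open_UNIV UNIV_I vector_field_zero]
  by (induction I rule: infinite_finite_induct) (simp_all add: vector_field_near_add)

text \<open>Constant coefficients in a coordinate frame extend a tangent vector.\<close>

lemma tangent_extend:
  assumes "v \<in> tangent_space A p"
  obtains X where "vector_field_near A p X" "X p = v"
proof -
  obtain c u where "c \<in> A" "p \<in> fst c" "v = coord_vec A c p u" using assms by (rule tangentE)
  then show thesis using that vector_field_nearI open_chart coord_field by metis
qed

lemma vector_field_near_coord: "c \<in> A \<Longrightarrow> p \<in> fst c \<Longrightarrow> vector_field_near A p (\<lambda>q. coord_vec A c q u)"
  using vector_field_nearI open_chart coord_field by blast

lemma smooth_near_vector_field: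
  assumes "vector_field_near A p X" "smooth_near A p f"
  shows "smooth_near A p (\<lambda>q. X q f)"
proof -
  obtain U V where UV: "open U" "p \<in> U" "vector_field A U X" "open V" "p \<in> V" "smooth_fun A V f"
    using assms unfolding vector_field_near_def smooth_near_def by blast
  then have "smooth_fun A (U \<inter> V) (\<lambda>q. X q f)"
    by (intro vector_field_smooth[OF UV(3)] smooth_fun_subset[OF UV(6)]) auto
  then show ?thesis by (rule smooth_nearI[rotated 2]) (use UV in auto)
qed

text \<open>In the chart this is the symmetry of second derivatives.\<close>

lemma coord_fields_commute:
  assumes c: "c \<in> A" "p \<in> fst c" and f: "smooth_near A p f"
  shows "coord_vec A c p u (\<lambda>q. coord_vec A c q v f) = coord_vec A c p v (\<lambda>q. coord_vec A c q u f)"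
proof -
  let ?F = "f \<circ> chart_inv c"
  obtain U where U: "open U" "p \<in> U" "smooth_fun A U f" using f unfolding smooth_near_def by blast
  let ?S = "snd c ` (U \<inter> fst c)"
  have S: "open ?S" "snd c p \<in> ?S" using open_chart_image[OF c(1) U(1)] U c by auto
  have "smooth_on ?S ?F" using U(3) c by (simp add: smooth_fun_iff)
  then have C2: "Ck_on 2 ?S ?F" by (simp add: smooth_on_def)
  have "coord_vec A c p u (\<lambda>q. coord_vec A c q v f) =
      frechet_derivative (\<lambda>y. frechet_derivative ?F (at y) v) (at (snd c p)) u" for u v
  proof -
    have sm: "smooth_near A p (\<lambda>q. coord_vec A c q v f)"
      using smooth_near_vector_field[OF vector_field_near_coord[OF c] f] .
    have "frechet_derivative ((\<lambda>q. coord_vec A c q v f) \<circ> chart_inv c) (at (snd c p)) =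
        frechet_derivative (\<lambda>y. frechet_derivative ?F (at y) v) (at (snd c p))"
    proof (rule frechet_derivative_cong_open[OF S])
      fix y assume "y \<in> ?S"
      then obtain q where q: "y = snd c q" "q \<in> U" "q \<in> fst c" by auto
      then have "smooth_near A q f" using U smooth_nearI by blast
      then show "((\<lambda>q. coord_vec A c q v f) \<circ> chart_inv c) y = frechet_derivative ?F (at y) v"
        using q chart_inv[OF c(1)] by (simp add: coord_vec_apply)
    qed
    then show ?thesis using coord_vec_apply[OF sm] by simp
  qed
  then show ?thesis using second_derivative_symmetric[OF S C2] by simp
qed

lemma vector_field_expand:
  assumes c: "c \<in> A" and X: "vector_field A U X" and q: "q \<in> U" "q \<in> fst c"
  shows "X q = (\<Sum>i\<in>Basis. X q (coord c i) *\<^sub>R coord_vec A c q i)"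
  using tangent_expand[OF c q(2) vector_field_tangent[OF X q(1)]] .

lemma sum_fun_apply: "(\<Sum>i\<in>I. f i) x = (\<Sum>i\<in>I. f i x)"
  by (induction I rule: infinite_finite_induct) simp_all

text \<open>In a coordinate frame the second-order parts of \<open>X (Y f)\<close> and \<open>Y (X f)\<close> cancel, which leaves a
  combination of the frame vectors.\<close>

lemma lie_bracket_tangent:
  assumes X: "vector_field_near A p X" and Y: "vector_field_near A p Y"
  shows "lie_bracket A X Y p \<in> tangent_space A p"
proof -
  obtain c where c: "c \<in> A" "p \<in> fst c" by (rule chart_at)
  let ?E = "\<lambda>i q. coord_vec A c q i"
  have second: "X p (\<lambda>q. Y q f) = (\<Sum>j\<in>Basis. X p (\<lambda>q. Y q (coord c j)) * ?E j p f) +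
      (\<Sum>j\<in>Basis. \<Sum>i\<in>Basis. Y p (coord c j) * X p (coord c i) * ?E i p (\<lambda>q. ?E j q f))"
    if f: "smooth_near A p f" and XY: "vector_field_near A p X" "vector_field_near A p Y" for f X Y
  proof -
    have v: "X p \<in> tangent_space A p" using vector_field_near_tangent[OF XY(1)] .
    obtain U where U: "open U" "p \<in> U" "vector_field A U Y"
      using XY(2) unfolding vector_field_near_def by blast
    have sY: "smooth_near A p (\<lambda>q. Y q (coord c j))" for j
      using smooth_near_vector_field[OF XY(2) smooth_near_coord[OF c]] .
    have sE: "smooth_near A p (\<lambda>q. ?E j q f)" for j
      using smooth_near_vector_field[OF vector_field_near_coord[OF c] f] .
    have Yf: "Y q f = (\<Sum>j\<in>Basis. Y q (coord c j) * ?E j q f)" if q: "q \<in> U \<inter> fst c" for q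
    proof -
      have "Y q f = (\<Sum>j\<in>Basis. Y q (coord c j) *\<^sub>R ?E j q) f"
        using vector_field_expand[OF c(1) U(3)] q by simp
      then show ?thesis by (simp add: sum_fun_apply scaleR_fun_def)
    qed
    have "X p (\<lambda>q. Y q f) = X p (\<lambda>q. \<Sum>j\<in>Basis. Y q (coord c j) * ?E j q f)"
    proof (rule tangent_cong[OF v])
      show "open (U \<inter> fst c)" using U(1) open_chart[OF c(1)] by blast
      show "p \<in> U \<inter> fst c" using U(2) c(2) by blast
      show "Y q f = (\<Sum>j\<in>Basis. Y q (coord c j) * ?E j q f)" if "q \<in> U \<inter> fst c" for q
        using Yf[OF that] .
    qed
    also have "\<dots> = (\<Sum>j\<in>Basis. X p (\<lambda>q. Y q (coord c j) * ?E j q f))"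
      by (rule tangent_sum[OF v smooth_near_mult[OF sY sE]])
    also have "\<dots> = (\<Sum>j\<in>Basis. X p (\<lambda>q. Y q (coord c j)) * ?E j p f +
        Y p (coord c j) * X p (\<lambda>q. ?E j q f))"
      by (simp add: tangent_mult[OF v sY sE])
    also have "\<dots> = (\<Sum>j\<in>Basis. X p (\<lambda>q. Y q (coord c j)) * ?E j p f +
        (\<Sum>i\<in>Basis. Y p (coord c j) * X p (coord c i) * ?E i p (\<lambda>q. ?E j q f)))"
    proof (intro sum.cong refl arg_cong2[where f="(+)"])
      fix j
      have "X p (\<lambda>q. ?E j q f) = (\<Sum>i\<in>Basis. X p (coord c i) *\<^sub>R ?E i p) (\<lambda>q. ?E j q f)"
        using tangent_expand[OF c v] by simp
      then show "Y p (coord c j) * X p (\<lambda>q. ?E j q f) =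
          (\<Sum>i\<in>Basis. Y p (coord c j) * X p (coord c i) * ?E i p (\<lambda>q. ?E j q f))"
        by (simp add: sum_fun_apply scaleR_fun_def sum_distrib_left mult.assoc)
    qed
    finally show ?thesis by (simp add: sum.distrib)
  qed
  have "lie_bracket A X Y p =
      (\<Sum>j\<in>Basis. (X p (\<lambda>q. Y q (coord c j)) - Y p (\<lambda>q. X q (coord c j))) *\<^sub>R ?E j p)" (is "_ = ?Z")
  proof
    fix f
    show "lie_bracket A X Y p f = ?Z f"
    proof (cases "smooth_near A p f")
      case f: True
      have "(\<Sum>j\<in>Basis. \<Sum>i\<in>Basis. Y p (coord c j) * X p (coord c i) * ?E i p (\<lambda>q. ?E j q f)) =
          (\<Sum>i\<in>Basis. \<Sum>j\<in>Basis. X p (coord c i) * Y p (coord c j) * ?E j p (\<lambda>q. ?E i q f))"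
      proof (subst sum.swap, intro sum.cong refl)
        fix i j
        show "Y p (coord c j) * X p (coord c i) * ?E i p (\<lambda>q. ?E j q f) =
            X p (coord c i) * Y p (coord c j) * ?E j p (\<lambda>q. ?E i q f)"
          using coord_fields_commute[OF c f, of i j] by (simp only: mult.commute)
      qed
      then show ?thesis
        using second[OF f X Y] second[OF f Y X] f
        by (simp add: lie_bracket_def sum_fun_apply scaleR_fun_def left_diff_distrib sum_subtractf)
    qed (simp add: lie_bracket_def sum_fun_apply scaleR_fun_def coord_vec_def)
  qed
  then show ?thesis using coord_vec_tangent[OF c] by (simp add: tangent_closed)
qed

end

section \<open>Symmetric bilinear forms and the induced connection\<close>

context smooth_atlas
begin

lemma sym_formsD:
  assumes "B \<in> sym_forms A p"
  shows "B u v = B v u"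
    and "u \<notin> tangent_space A p \<Longrightarrow> B u v = 0" and "v \<notin> tangent_space A p \<Longrightarrow> B u v = 0"
    and "u \<in> tangent_space A p \<Longrightarrow> v \<in> tangent_space A p \<Longrightarrow> w \<in> tangent_space A p \<Longrightarrow>
      B (a *\<^sub>R u + b *\<^sub>R v) w = a * B u w + b * B v w"
  using assms unfolding sym_forms_def by blast+

lemma form_add:
  assumes "B \<in> sym_forms A p" "u \<in> tangent_space A p" "v \<in> tangent_space A p" "w \<in> tangent_space A p"
  shows "B (u + v) w = B u w + B v w" "B w (u + v) = B w u + B w v"
  using sym_formsD(4)[OF assms, of 1 1] sym_formsD(1)[OF assms(1), of w] by simp_all

lemma form_scale:
  assumes "B \<in> sym_forms A p" "u \<in> tangent_space A p" "w \<in> tangent_space A p"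
  shows "B (a *\<^sub>R u) w = a * B u w" "B w (a *\<^sub>R u) = a * B w u"
  using sym_formsD(4)[OF assms(1,2,2,3), of a 0] sym_formsD(1)[OF assms(1), of w] by simp_all

lemma form_diff:
  assumes "B \<in> sym_forms A p" "u \<in> tangent_space A p" "v \<in> tangent_space A p" "w \<in> tangent_space A p"
  shows "B (u - v) w = B u w - B v w" "B w (u - v) = B w u - B w v"
  using sym_formsD(4)[OF assms, of 1 "- 1"] sym_formsD(1)[OF assms(1), of w] by simp_all

lemma sym_forms_eqI:
  assumes "B \<in> sym_forms A p" "C \<in> sym_forms A p"
    and "\<And>u v. u \<in> tangent_space A p \<Longrightarrow> v \<in> tangent_space A p \<Longrightarrow> B u v = C u v"
  shows "B = C"
proof (intro ext)
  fix u v
  show "B u v = C u v"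
    using assms(3)[of u v] sym_formsD(2,3)[OF assms(1)] sym_formsD(2,3)[OF assms(2)] by metis
qed

lemma sym_formsI:
  assumes "\<And>u v. B u v = B v u" "\<And>u v. u \<notin> tangent_space A p \<Longrightarrow> B u v = 0"
    and "\<And>u v w a b. u \<in> tangent_space A p \<Longrightarrow> v \<in> tangent_space A p \<Longrightarrow> w \<in> tangent_space A p \<Longrightarrow>
      B (a *\<^sub>R u + b *\<^sub>R v) w = a * B u w + b * B v w"
  shows "B \<in> sym_forms A p"
proof -
  have "B u v = 0" if "v \<notin> tangent_space A p" for u v using assms(1)[of u v] assms(2)[OF that] by simp
  then show ?thesis unfolding sym_forms_def using assms by blast
qed

lemma form_scaleR_apply: "(r *\<^sub>R (B :: 'm form)) u v = r * B u v"
  by (simp add: scaleR_fun_def)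

lemma subspace_sym_forms: "subspace (sym_forms A p)"
  unfolding subspace_def
proof (intro conjI ballI allI)
  show "0 \<in> sym_forms A p" by (rule sym_formsI) simp_all
  fix B C assume B: "B \<in> sym_forms A p" and C: "C \<in> sym_forms A p"
  show "B + C \<in> sym_forms A p"
  proof (rule sym_formsI)
    show "(B + C) u v = (B + C) v u" for u v
      using sym_formsD(1)[OF B, of u v] sym_formsD(1)[OF C, of u v] by simp
  qed (simp_all add: sym_formsD(2,4)[OF B] sym_formsD(2,4)[OF C] algebra_simps)
next
  fix r B assume B: "B \<in> sym_forms A p"
  show "r *\<^sub>R B \<in> sym_forms A p"
  proof (rule sym_formsI)
    show "(r *\<^sub>R B) u v = (r *\<^sub>R B) v u" for u v
      using sym_formsD(1)[OF B, of u v] by (simp add: form_scaleR_apply)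
  qed (simp_all add: sym_formsD(2,4)[OF B] form_scaleR_apply algebra_simps)
qed

definition form_near :: "'m \<Rightarrow> ('m \<Rightarrow> 'm form) \<Rightarrow> bool"
  where "form_near p h \<longleftrightarrow> (\<exists>U. open U \<and> p \<in> U \<and> W_section A U h)"

lemma form_nearI: "open U \<Longrightarrow> p \<in> U \<Longrightarrow> W_section A U h \<Longrightarrow> form_near p h"
  unfolding form_near_def by blast

lemma W_section_form: "W_section A U h \<Longrightarrow> p \<in> U \<Longrightarrow> h p \<in> sym_forms A p"
  unfolding W_section_def by blast

lemma W_section_smooth:
  "W_section A U h \<Longrightarrow> open V \<Longrightarrow> V \<subseteq> U \<Longrightarrow> vector_field A V X \<Longrightarrow> vector_field A V Y \<Longrightarrow>
    smooth_fun A V (\<lambda>p. h p (X p) (Y p))"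
  unfolding W_section_def by blast

lemma W_section_subset: "W_section A U h \<Longrightarrow> V \<subseteq> U \<Longrightarrow> W_section A V h"
  unfolding W_section_def by (meson subset_trans subsetD)

lemma form_near_form: "form_near p h \<Longrightarrow> h p \<in> sym_forms A p"
  unfolding form_near_def using W_section_form by blast

lemma form_near_smooth:
  assumes "form_near p h" "vector_field_near A p X" "vector_field_near A p Y"
  shows "smooth_near A p (\<lambda>q. h q (X q) (Y q))"
proof -
  obtain U where U: "open U" "p \<in> U" "W_section A U h" using assms(1) unfolding form_near_def by blast
  obtain V where V: "open V" "p \<in> V" "vector_field A V X" "vector_field A V Y"
    using vector_field_near_common[OF assms(2,3)] .
  have "smooth_fun A (U \<inter> V) (\<lambda>q. h q (X q) (Y q))"
    by (rule W_section_smooth[OF U(3)]) (use U V in \<open>auto intro: vector_field_subset\<close>)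
  then show ?thesis by (rule smooth_nearI[rotated 2]) (use U V in auto)
qed

lemma W_section_scale:
  assumes h: "W_section A U h" and a: "smooth_fun A U a"
  shows "W_section A U (\<lambda>q. a q *\<^sub>R h q)"
  unfolding W_section_def
proof (intro conjI ballI allI impI)
  show "a p *\<^sub>R h p \<in> sym_forms A p" if "p \<in> U" for p
    using subspace_scale[OF subspace_sym_forms W_section_form[OF h that]] .
  fix V X Y assume V: "open V" "V \<subseteq> U" "vector_field A V X" "vector_field A V Y"
  have "smooth_fun A V (\<lambda>p. a p * h p (X p) (Y p))"
    by (rule smooth_fun_mult[OF V(1) smooth_fun_subset[OF a V(2)] W_section_smooth[OF h V]])
  then show "smooth_fun A V (\<lambda>p. (a p *\<^sub>R h p) (X p) (Y p))" by (simp add: scaleR_fun_def)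
qed

text \<open>Expansion in a coordinate frame shows that a functional of vector fields that is linear over
  smooth functions only sees the value of the field at the point.\<close>

lemma tensorial:
  fixes T :: "'m vfield \<Rightarrow> real"
  assumes germ: "\<And>Y Z U. open U \<Longrightarrow> p \<in> U \<Longrightarrow> (\<And>q. q \<in> U \<Longrightarrow> Y q = Z q) \<Longrightarrow> vector_field_near A p Y \<Longrightarrow> T Y = T Z"
    and add: "\<And>Y Z. vector_field_near A p Y \<Longrightarrow> vector_field_near A p Z \<Longrightarrow> T (\<lambda>q. Y q + Z q) = T Y + T Z"
    and scale: "\<And>a Y. smooth_near A p a \<Longrightarrow> vector_field_near A p Y \<Longrightarrow> T (\<lambda>q. a q *\<^sub>R Y q) = a p * T Y"
    and Y: "vector_field_near A p Y" and Z: "vector_field_near A p Z" and eq: "Y p = Z p"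
  shows "T Y = T Z"
proof -
  obtain c where c: "c \<in> A" "p \<in> fst c" by (rule chart_at)
  have near0: "vector_field_near A p (\<lambda>q. 0)"
    using vector_field_nearI[OF open_UNIV UNIV_I vector_field_zero] .
  have T0: "T (\<lambda>q. 0) = 0" using scale[OF smooth_near_const near0, of 0] by simp
  have T_sum: "T (\<lambda>q. \<Sum>i\<in>I. X i q) = (\<Sum>i\<in>I. T (X i))"
    if "\<And>i. i \<in> I \<Longrightarrow> vector_field_near A p (X i)" for I :: "'e set" and X
    using that by (induction I rule: infinite_finite_induct) (simp_all add: T0 add vector_field_near_sum)
  have "T X = (\<Sum>i\<in>Basis. X p (coord c i) * T (\<lambda>q. coord_vec A c q i))"
    if X: "vector_field_near A p X" for X
  proof -
    let ?X = "\<lambda>q. \<Sum>i\<in>Basis. X q (coord c i) *\<^sub>R coord_vec A c q i"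
    obtain U where U: "open U" "p \<in> U" "vector_field A U X" using X unfolding vector_field_near_def by blast
    have a: "smooth_near A p (\<lambda>q. X q (coord c i))" for i
      by (rule smooth_near_vector_field[OF X smooth_near_coord[OF c]])
    have E: "vector_field_near A p (\<lambda>q. coord_vec A c q i)" for i using vector_field_near_coord[OF c] .
    have "T X = T ?X"
    proof (rule germ)
      show "open (U \<inter> fst c)" using U(1) open_chart[OF c(1)] by blast
      show "X q = ?X q" if "q \<in> U \<inter> fst c" for q using vector_field_expand[OF c(1) U(3)] that by blast
    qed (use U c X in auto)
    also have "\<dots> = (\<Sum>i\<in>Basis. T (\<lambda>q. X q (coord c i) *\<^sub>R coord_vec A c q i))"
      by (rule T_sum) (rule vector_field_near_scale[OF E a])
    finally show ?thesis by (simp add: scale[OF a E])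
  qed
  then show ?thesis using Y Z eq by simp
qed

end

locale affine_connection = smooth_atlas A
  for A :: "('m::{t2_space, second_countable_topology}, 'e::euclidean_space) chart set" +
  fixes N :: "'m covariant_derivative"
  assumes connection: "is_connection A N"
begin

lemma N_tangent: "v \<in> tangent_space A p \<Longrightarrow> vector_field_near A p Y \<Longrightarrow> N p v Y \<in> tangent_space A p"
  using connection unfolding is_connection_def by simp

lemma N_add:
  "v \<in> tangent_space A p \<Longrightarrow> vector_field_near A p Y \<Longrightarrow> vector_field_near A p Z \<Longrightarrow>
    N p v (\<lambda>q. Y q + Z q) = N p v Y + N p v Z"
  using connection unfolding is_connection_def by simp

lemma N_scale:
  "v \<in> tangent_space A p \<Longrightarrow> smooth_near A p a \<Longrightarrow> vector_field_near A p Y \<Longrightarrow>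
    N p v (\<lambda>q. a q *\<^sub>R Y q) = v a *\<^sub>R Y p + a p *\<^sub>R N p v Y"
  using connection unfolding is_connection_def by simp

lemma N_field: "open U \<Longrightarrow> vector_field A U X \<Longrightarrow> vector_field A U Y \<Longrightarrow> vector_field A U (\<lambda>p. N p (X p) Y)"
  using connection unfolding is_connection_def by blast

lemma N_cong:
  assumes v: "v \<in> tangent_space A p" and Y: "vector_field_near A p Y"
    and U: "open U" "p \<in> U" "\<And>q. q \<in> U \<Longrightarrow> Y q = Z q"
  shows "N p v Y = N p v Z"
proof -
  have *: "N p v Y = N p v Z"
    if "open V" "p \<in> V" "vector_field A V Y" "\<forall>q\<in>V. Y q = Z q" for V
    using connection v that unfolding is_connection_def by blast
  obtain V where "open V" "p \<in> V" "vector_field A V Y" using Y unfolding vector_field_near_def by blast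
  then show ?thesis using U vector_field_subset by (intro *[of "U \<inter> V"]) auto
qed

text \<open>The value that the product rule forces on \<open>(\<nabla>\<^sub>v h)(Y, Z)\<close>.\<close>

definition nabla_form :: "'m \<Rightarrow> 'm tvec \<Rightarrow> ('m \<Rightarrow> 'm form) \<Rightarrow> 'm vfield \<Rightarrow> 'm vfield \<Rightarrow> real"
  where "nabla_form p v h Y Z = v (\<lambda>q. h q (Y q) (Z q)) - h p (N p v Y) (Z p) - h p (Y p) (N p v Z)"

lemma nabla_form_commute:
  assumes v: "v \<in> tangent_space A p" and h: "form_near p h"
  shows "nabla_form p v h Y Z = nabla_form p v h Z Y"
proof -
  obtain U where U: "open U" "p \<in> U" "W_section A U h" using h unfolding form_near_def by blast
  have "v (\<lambda>q. h q (Y q) (Z q)) = v (\<lambda>q. h q (Z q) (Y q))"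
    by (rule tangent_cong[OF v U(1,2)]) (rule sym_formsD(1)[OF W_section_form[OF U(3)]])
  then show ?thesis
    using sym_formsD(1)[OF form_near_form[OF h]] by (simp add: nabla_form_def)
qed

lemma nabla_form_germ:
  assumes v: "v \<in> tangent_space A p"
    and "open U" "p \<in> U" "\<And>q. q \<in> U \<Longrightarrow> Y q = Y' q" "vector_field_near A p Y"
  shows "nabla_form p v h Y Z = nabla_form p v h Y' Z"
proof -
  have "v (\<lambda>q. h q (Y q) (Z q)) = v (\<lambda>q. h q (Y' q) (Z q))"
    by (rule tangent_cong[OF v assms(2,3)]) (simp add: assms(4))
  moreover have "N p v Y = N p v Y'" by (rule N_cong[OF v assms(5,2,3,4)])
  ultimately show ?thesis using assms(3,4) by (simp add: nabla_form_def)
qed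

lemma nabla_form_add:
  assumes v: "v \<in> tangent_space A p" and h: "form_near p h" and Y: "vector_field_near A p Y"
    and Y': "vector_field_near A p Y'" and Z: "vector_field_near A p Z"
  shows "nabla_form p v h (\<lambda>q. Y q + Y' q) Z = nabla_form p v h Y Z + nabla_form p v h Y' Z"
proof -
  note hp = form_near_form[OF h]
  note t = vector_field_near_tangent[OF Y] vector_field_near_tangent[OF Y'] vector_field_near_tangent[OF Z]
  note n = N_tangent[OF v Y] N_tangent[OF v Y'] N_tangent[OF v Z]
  obtain U where U: "open U" "p \<in> U" "W_section A U h" using h unfolding form_near_def by blast
  obtain V where V: "open V" "p \<in> V" "vector_field A V Y" "vector_field A V Y'"
    using vector_field_near_common[OF Y Y'] .
  obtain V' where V': "open V'" "p \<in> V'" "vector_field A V' Z" using Z unfolding vector_field_near_def by blast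
  have "v (\<lambda>q. h q (Y q + Y' q) (Z q)) = v (\<lambda>q. h q (Y q) (Z q) + h q (Y' q) (Z q))"
  proof (rule tangent_cong[OF v])
    show "h q (Y q + Y' q) (Z q) = h q (Y q) (Z q) + h q (Y' q) (Z q)" if "q \<in> U \<inter> V \<inter> V'" for q
      using that by (intro form_add(1)[OF W_section_form[OF U(3)]] vector_field_tangent[OF V(3)]
          vector_field_tangent[OF V(4)] vector_field_tangent[OF V'(3)]) auto
  qed (use U V V' in auto)
  also have "\<dots> = v (\<lambda>q. h q (Y q) (Z q)) + v (\<lambda>q. h q (Y' q) (Z q))"
    by (rule tangent_add[OF v form_near_smooth[OF h Y Z] form_near_smooth[OF h Y' Z]])
  finally show ?thesis
    using t n by (simp add: nabla_form_def N_add[OF v Y Y'] form_add[OF hp])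
qed

lemma nabla_form_scale:
  assumes v: "v \<in> tangent_space A p" and h: "form_near p h" and a: "smooth_near A p a"
    and Y: "vector_field_near A p Y" and Z: "vector_field_near A p Z"
  shows "nabla_form p v h (\<lambda>q. a q *\<^sub>R Y q) Z = a p * nabla_form p v h Y Z"
proof -
  note hp = form_near_form[OF h]
  note t = vector_field_near_tangent[OF Y] vector_field_near_tangent[OF Z]
  note n = N_tangent[OF v Y] N_tangent[OF v Z]
  obtain U where U: "open U" "p \<in> U" "W_section A U h" using h unfolding form_near_def by blast
  obtain V where V: "open V" "p \<in> V" "vector_field A V Y" "vector_field A V Z"
    using vector_field_near_common[OF Y Z] .
  have "v (\<lambda>q. h q (a q *\<^sub>R Y q) (Z q)) = v (\<lambda>q. a q * h q (Y q) (Z q))"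
  proof (rule tangent_cong[OF v])
    show "h q (a q *\<^sub>R Y q) (Z q) = a q * h q (Y q) (Z q)" if "q \<in> U \<inter> V" for q
      using that by (intro form_scale(1)[OF W_section_form[OF U(3)]] vector_field_tangent[OF V(3)]
          vector_field_tangent[OF V(4)]) auto
  qed (use U V in auto)
  also have "\<dots> = v a * h p (Y p) (Z p) + a p * v (\<lambda>q. h q (Y q) (Z q))"
    by (rule tangent_mult[OF v a form_near_smooth[OF h Y Z]])
  finally show ?thesis
    using t n
    by (simp add: nabla_form_def N_scale[OF v a Y] form_add[OF hp] form_scale[OF hp] tangent_closed algebra_simps)
qed

text \<open>Tensoriality in the first argument, transferred to the second one by symmetry.\<close>

lemma nabla_form_pointwise:
  assumes v: "v \<in> tangent_space A p" and h: "form_near p h"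
    and Y: "vector_field_near A p Y" "vector_field_near A p Y'" "Y p = Y' p"
    and Z: "vector_field_near A p Z" "vector_field_near A p Z'" "Z p = Z' p"
  shows "nabla_form p v h Y Z = nabla_form p v h Y' Z'"
proof -
  have left: "nabla_form p v h Y Z = nabla_form p v h Y' Z"
    if "vector_field_near A p Y" "vector_field_near A p Y'" "Y p = Y' p" "vector_field_near A p Z" for Y Y' Z
  proof (rule tensorial[of p "\<lambda>Y. nabla_form p v h Y Z"])
    fix Y1 Y2 U
    assume "open U" "p \<in> U" "\<And>q. q \<in> U \<Longrightarrow> Y1 q = Y2 q" "vector_field_near A p Y1"
    then show "nabla_form p v h Y1 Z = nabla_form p v h Y2 Z" by (rule nabla_form_germ[OF v])
  next
    fix Y1 Y2 assume "vector_field_near A p Y1" "vector_field_near A p Y2"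
    then show "nabla_form p v h (\<lambda>q. Y1 q + Y2 q) Z = nabla_form p v h Y1 Z + nabla_form p v h Y2 Z"
      using that(4) by (rule nabla_form_add[OF v h])
  next
    fix a Y1 assume "smooth_near A p a" "vector_field_near A p Y1"
    then show "nabla_form p v h (\<lambda>q. a q *\<^sub>R Y1 q) Z = a p * nabla_form p v h Y1 Z"
      using that(4) by (rule nabla_form_scale[OF v h])
  qed (use that in auto)
  have "nabla_form p v h Y Z = nabla_form p v h Y' Z" by (rule left[OF Y Z(1)])
  also have "\<dots> = nabla_form p v h Z Y'" by (rule nabla_form_commute[OF v h])
  also have "\<dots> = nabla_form p v h Z' Y'" by (rule left[OF Z Y(2)])
  finally show ?thesis using nabla_form_commute[OF v h] by simp
qed

definition product_rule :: "'m \<Rightarrow> 'm tvec \<Rightarrow> ('m \<Rightarrow> 'm form) \<Rightarrow> 'm form \<Rightarrow> bool"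
  where "product_rule p v h B \<longleftrightarrow> (\<forall>Y Z. vector_field_near A p Y \<longrightarrow> vector_field_near A p Z \<longrightarrow>
    v (\<lambda>q. h q (Y q) (Z q)) = B (Y p) (Z p) + h p (N p v Y) (Z p) + h p (Y p) (N p v Z))"

lemma product_rule_unique:
  assumes "B \<in> sym_forms A p" "product_rule p v h B" "C \<in> sym_forms A p" "product_rule p v h C"
  shows "B = C"
proof (rule sym_forms_eqI[OF assms(1,3)])
  fix a b assume ab: "a \<in> tangent_space A p" "b \<in> tangent_space A p"
  obtain Y where Y: "vector_field_near A p Y" "Y p = a" using tangent_extend[OF ab(1)] .
  obtain Z where Z: "vector_field_near A p Z" "Z p = b" using tangent_extend[OF ab(2)] .
  have "B (Y p) (Z p) + h p (N p v Y) (Z p) + h p (Y p) (N p v Z) =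
      C (Y p) (Z p) + h p (N p v Y) (Z p) + h p (Y p) (N p v Z)"
    using assms(2,4) Y(1) Z(1) unfolding product_rule_def by metis
  then show "B a b = C a b" using Y Z by simp
qed

text \<open>By \<open>nabla_form_pointwise\<close> any extension of two tangent vectors to fields gives the same value, and
  extensions can be chosen compatibly with linear combinations.\<close>

lemma product_rule_exists:
  assumes v: "v \<in> tangent_space A p" and h: "form_near p h"
  shows "\<exists>B \<in> sym_forms A p. product_rule p v h B"
proof -
  define ext where "ext = (\<lambda>a. SOME X. vector_field_near A p X \<and> X p = a)"
  have ext: "vector_field_near A p (ext a)" "ext a p = a" if a: "a \<in> tangent_space A p" for a
  proof -
    obtain X where "vector_field_near A p X \<and> X p = a" using tangent_extend[OF a] by blast
    then have "vector_field_near A p (ext a) \<and> ext a p = a" unfolding ext_def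
      by (rule someI[where P="\<lambda>X. vector_field_near A p X \<and> X p = a"])
    then show "vector_field_near A p (ext a)" "ext a p = a" by auto
  qed
  define B where "B = (\<lambda>a b. if a \<in> tangent_space A p \<and> b \<in> tangent_space A p
    then nabla_form p v h (ext a) (ext b) else 0)"
  have B: "B (Y p) (Z p) = nabla_form p v h Y Z"
    if "vector_field_near A p Y" "vector_field_near A p Z" for Y Z
  proof -
    note t = vector_field_near_tangent[OF that(1)] vector_field_near_tangent[OF that(2)]
    have "nabla_form p v h (ext (Y p)) (ext (Z p)) = nabla_form p v h Y Z"
      by (rule nabla_form_pointwise[OF v h]) (use ext[OF t(1)] ext[OF t(2)] that in auto)
    then show ?thesis using t by (simp add: B_def)
  qed
  have sym: "B a b = B b a" for a b
    using nabla_form_commute[OF v h] by (simp add: B_def)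
  have lin: "B (r *\<^sub>R a + s *\<^sub>R b) c = r * B a c + s * B b c"
    if abc: "a \<in> tangent_space A p" "b \<in> tangent_space A p" "c \<in> tangent_space A p" for a b c r s
  proof -
    note X = ext[OF abc(1)] and Y = ext[OF abc(2)] and Z = ext[OF abc(3)]
    note rX = vector_field_near_scale[OF X(1) smooth_near_const] and sY = vector_field_near_scale[OF Y(1) smooth_near_const]
    have "B (r *\<^sub>R a + s *\<^sub>R b) c = nabla_form p v h (\<lambda>q. r *\<^sub>R ext a q + s *\<^sub>R ext b q) (ext c)"
      using B[OF vector_field_near_add[OF rX sY] Z(1)] X Y Z by simp
    also have "\<dots> = r * nabla_form p v h (ext a) (ext c) + s * nabla_form p v h (ext b) (ext c)"
      by (simp add: nabla_form_add[OF v h rX sY Z(1)] nabla_form_scale[OF v h smooth_near_const X(1) Z(1)]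
          nabla_form_scale[OF v h smooth_near_const Y(1) Z(1)])
    finally show ?thesis using abc by (simp add: B_def)
  qed
  have "B \<in> sym_forms A p" by (rule sym_formsI[OF sym _ lin]) (simp add: B_def)
  moreover have "product_rule p v h B"
    unfolding product_rule_def using B by (simp add: nabla_form_def)
  ultimately show ?thesis by blast
qed

lemma nabla_W_iff: "nabla_W A N p v h = (THE B. B \<in> sym_forms A p \<and> product_rule p v h B)"
  unfolding nabla_W_def product_rule_def ..

lemma nabla_W_eqI:
  assumes "B \<in> sym_forms A p" "product_rule p v h B"
  shows "nabla_W A N p v h = B"
  unfolding nabla_W_iff using assms product_rule_unique by blast

lemma
  assumes "v \<in> tangent_space A p" "form_near p h"
  shows nabla_W_form: "nabla_W A N p v h \<in> sym_forms A p"
    and nabla_W_product_rule: "product_rule p v h (nabla_W A N p v h)"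
  using product_rule_exists[OF assms] nabla_W_eqI by metis+

lemma nabla_W_apply:
  assumes "v \<in> tangent_space A p" "form_near p h" "vector_field_near A p Y" "vector_field_near A p Z"
  shows "nabla_W A N p v h (Y p) (Z p) =
    v (\<lambda>q. h q (Y q) (Z q)) - h p (N p v Y) (Z p) - h p (Y p) (N p v Z)"
  using nabla_W_product_rule[OF assms(1,2)] assms(3,4) unfolding product_rule_def by simp

text \<open>Needed to differentiate twice: \<open>\<nabla>\<^sub>X h\<close> is smooth because the product rule expresses its values on
  smooth fields by smooth functions.\<close>

lemma nabla_W_section:
  assumes U: "open U" and X: "vector_field A U X" and h: "W_section A U h"
  shows "W_section A U (\<lambda>q. nabla_W A N q (X q) h)"
  unfolding W_section_def
proof (intro conjI ballI allI impI)
  show "nabla_W A N p (X p) h \<in> sym_forms A p" if "p \<in> U" for p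
    using nabla_W_form[OF vector_field_tangent[OF X that] form_nearI[OF U that h]] .
  fix V Y Z assume V: "open V" "V \<subseteq> U" and Y: "vector_field A V Y" and Z: "vector_field A V Z"
  have XV: "vector_field A V X" using vector_field_subset[OF X V(2)] .
  note hs = W_section_smooth[OF h V]
  have "smooth_fun A V (\<lambda>p. X p (\<lambda>q. h q (Y q) (Z q)) - h p (N p (X p) Y) (Z p) - h p (Y p) (N p (X p) Z))"
    by (intro smooth_fun_diff[OF V(1)] vector_field_smooth[OF XV V(1) order_refl] hs N_field[OF V(1) XV] Y Z)
  then show "smooth_fun A V (\<lambda>p. nabla_W A N p (X p) h (Y p) (Z p))"
  proof (rule smooth_fun_cong[OF V(1), rotated])
    fix p assume p: "p \<in> V"
    then have "p \<in> U" using V by auto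
    then show "X p (\<lambda>q. h q (Y q) (Z q)) - h p (N p (X p) Y) (Z p) - h p (Y p) (N p (X p) Z) =
        nabla_W A N p (X p) h (Y p) (Z p)"
      using nabla_W_apply[OF vector_field_tangent[OF X] form_nearI[OF U _ h] vector_field_nearI[OF V(1) p Y]
          vector_field_nearI[OF V(1) p Z]] by simp
  qed
qed

lemma nabla_W_zero:
  assumes v: "v \<in> tangent_space A p" and U: "open U" "p \<in> U" "\<And>q. q \<in> U \<Longrightarrow> h q = 0"
  shows "nabla_W A N p v h = 0"
proof (rule nabla_W_eqI)
  show "0 \<in> sym_forms A p" using subspace_0[OF subspace_sym_forms] .
  have "v (\<lambda>q. h q (Y q) (Z q)) = v (\<lambda>q. 0)" for Y Z
    by (rule tangent_cong[OF v U(1,2)]) (simp add: U(3))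
  then show "product_rule p v h 0"
    unfolding product_rule_def using tangent_const[OF v] U by simp
qed

lemma nabla_W_scale:
  assumes v: "v \<in> tangent_space A p" and a: "smooth_near A p a" and h: "form_near p h"
  shows "nabla_W A N p v (\<lambda>q. a q *\<^sub>R h q) = v a *\<^sub>R h p + a p *\<^sub>R nabla_W A N p v h"
proof (rule nabla_W_eqI)
  show "v a *\<^sub>R h p + a p *\<^sub>R nabla_W A N p v h \<in> sym_forms A p"
    using form_near_form[OF h] nabla_W_form[OF v h] subspace_sym_forms by (simp add: subspace_add subspace_scale)
  show "product_rule p v (\<lambda>q. a q *\<^sub>R h q) (v a *\<^sub>R h p + a p *\<^sub>R nabla_W A N p v h)"
    unfolding product_rule_def
  proof (intro allI impI)
    fix Y Z assume Y: "vector_field_near A p Y" and Z: "vector_field_near A p Z"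
    have E: "v (\<lambda>q. h q (Y q) (Z q)) =
        nabla_W A N p v h (Y p) (Z p) + h p (N p v Y) (Z p) + h p (Y p) (N p v Z)"
      using nabla_W_apply[OF v h Y Z] by simp
    have "v (\<lambda>q. a q * h q (Y q) (Z q)) = v a * h p (Y p) (Z p) + a p * v (\<lambda>q. h q (Y q) (Z q))"
      by (rule tangent_mult[OF v a form_near_smooth[OF h Y Z]])
    then show "v (\<lambda>q. (a q *\<^sub>R h q) (Y q) (Z q)) = (v a *\<^sub>R h p + a p *\<^sub>R nabla_W A N p v h) (Y p) (Z p) +
        (a p *\<^sub>R h p) (N p v Y) (Z p) + (a p *\<^sub>R h p) (Y p) (N p v Z)"
      unfolding E by (simp add: scaleR_fun_def algebra_simps)
  qed
qed

section \<open>Curvature of the bundle of symmetric forms\<close>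

text \<open>This is \<open>- R(X, Y) Z\<close> for the curvature \<open>R\<close> on the tangent bundle; the sign is the one with which
  it acts on forms.\<close>

definition neg_tangent_curvature :: "'m vfield \<Rightarrow> 'm vfield \<Rightarrow> 'm vfield \<Rightarrow> 'm \<Rightarrow> 'm tvec"
  where "neg_tangent_curvature X Y Z p = N p (Y p) (\<lambda>q. N q (X q) Z) - N p (X p) (\<lambda>q. N q (Y q) Z) +
    N p (lie_bracket A X Y p) Z"

text \<open>Both second derivatives of \<open>h\<close> are expanded by the product rule. After antisymmetrization the second
  derivatives of \<open>h(Z, T)\<close> cancel against \<open>[X, Y]\<close> and the mixed terms \<open>h(\<nabla>\<^sub>X Z, \<nabla>\<^sub>Y T)\<close> cancel each
  other; what is left contains no derivative of \<open>h\<close>.\<close>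

lemma curvature_on_fields_apply:
  assumes U: "open U" "p \<in> U" and X: "vector_field A U X" and Y: "vector_field A U Y"
    and h: "W_section A U h" and Z: "vector_field A U Z" and T: "vector_field A U T"
  shows "curvature_on_fields A N X Y h p (Z p) (T p) =
    h p (neg_tangent_curvature X Y Z p) (T p) + h p (Z p) (neg_tangent_curvature X Y T p)"
proof -
  note near = vector_field_nearI[OF U]
  note hn = form_nearI[OF U h]
  note hp = form_near_form[OF hn]
  let ?H = "\<lambda>q. h q (Z q) (T q)"
  have second: "nabla_W A N p (X p) (\<lambda>q. nabla_W A N q (Y q) h) (Z p) (T p) =
      X p (\<lambda>q. Y q ?H)
      - X p (\<lambda>q. h q (N q (Y q) Z) (T q)) - X p (\<lambda>q. h q (Z q) (N q (Y q) T))
      - Y p (\<lambda>q. h q (N q (X q) Z) (T q)) - Y p (\<lambda>q. h q (Z q) (N q (X q) T))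
      + h p (N p (Y p) (\<lambda>q. N q (X q) Z)) (T p) + h p (Z p) (N p (Y p) (\<lambda>q. N q (X q) T))
      + h p (N p (X p) Z) (N p (Y p) T) + h p (N p (Y p) Z) (N p (X p) T)"
    if X: "vector_field A U X" and Y: "vector_field A U Y" for X Y
  proof -
    note Xp = vector_field_tangent[OF X U(2)] and Yp = vector_field_tangent[OF Y U(2)]
    note XZ = N_field[OF U(1) X Z] and XT = N_field[OF U(1) X T]
      and YZ = N_field[OF U(1) Y Z] and YT = N_field[OF U(1) Y T]
    note hs = form_near_smooth[OF hn]
    have "X p (\<lambda>q. nabla_W A N q (Y q) h (Z q) (T q)) =
        X p (\<lambda>q. Y q ?H - h q (N q (Y q) Z) (T q) - h q (Z q) (N q (Y q) T))"
      by (rule tangent_cong[OF Xp U])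
         (rule nabla_W_apply[OF vector_field_tangent[OF Y] form_nearI[OF U(1) _ h]
            vector_field_nearI[OF U(1) _ Z] vector_field_nearI[OF U(1) _ T]])
    also have "\<dots> = X p (\<lambda>q. Y q ?H) - X p (\<lambda>q. h q (N q (Y q) Z) (T q)) - X p (\<lambda>q. h q (Z q) (N q (Y q) T))"
    proof -
      have s: "smooth_near A p (\<lambda>q. Y q ?H)"
        by (rule smooth_near_vector_field[OF near[OF Y] hs[OF near[OF Z] near[OF T]]])
      have s': "smooth_near A p (\<lambda>q. Y q ?H - h q (N q (Y q) Z) (T q))"
        using smooth_near_add[OF s smooth_near_mult[OF smooth_near_const hs[OF near[OF YZ] near[OF T]]], of "- 1"]
        by simp
      show ?thesis
        by (simp only: tangent_diff[OF Xp s' hs[OF near[OF Z] near[OF YT]]]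
            tangent_diff[OF Xp s hs[OF near[OF YZ] near[OF T]]])
    qed
    finally have first: "X p (\<lambda>q. nabla_W A N q (Y q) h (Z q) (T q)) = \<dots>" .
    have "nabla_W A N p (X p) (\<lambda>q. nabla_W A N q (Y q) h) (Z p) (T p) =
        X p (\<lambda>q. nabla_W A N q (Y q) h (Z q) (T q)) - nabla_W A N p (Y p) h (N p (X p) Z) (T p)
        - nabla_W A N p (Y p) h (Z p) (N p (X p) T)"
      by (rule nabla_W_apply[OF Xp form_nearI[OF U nabla_W_section[OF U(1) Y h]] near[OF Z] near[OF T]])
    then show ?thesis
      using first nabla_W_apply[OF Yp hn near[OF XZ] near[OF T]]
        nabla_W_apply[OF Yp hn near[OF Z] near[OF XT]] by simp
  qed
  note L = lie_bracket_tangent[OF near[OF X] near[OF Y]]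
  have "lie_bracket A X Y p ?H = X p (\<lambda>q. Y q ?H) - Y p (\<lambda>q. X q ?H)"
    using form_near_smooth[OF hn near[OF Z] near[OF T]] by (simp add: lie_bracket_def)
  then have L_apply: "nabla_W A N p (lie_bracket A X Y p) h (Z p) (T p) =
      X p (\<lambda>q. Y q ?H) - Y p (\<lambda>q. X q ?H) - h p (N p (lie_bracket A X Y p) Z) (T p)
      - h p (Z p) (N p (lie_bracket A X Y p) T)"
    using nabla_W_apply[OF L hn near[OF Z] near[OF T]] by simp
  have left: "h p (neg_tangent_curvature X Y S p) w =
      h p (N p (Y p) (\<lambda>q. N q (X q) S)) w - h p (N p (X p) (\<lambda>q. N q (Y q) S)) w
      + h p (N p (lie_bracket A X Y p) S) w"
    if S: "vector_field A U S" and w: "w \<in> tangent_space A p" for S w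
  proof -
    have "N p (Y p) (\<lambda>q. N q (X q) S) \<in> tangent_space A p" "N p (X p) (\<lambda>q. N q (Y q) S) \<in> tangent_space A p"
      by (rule N_tangent[OF vector_field_tangent[OF _ U(2)] near[OF N_field[OF U(1)]]]; fact X Y S)+
    then show ?thesis
      using w N_tangent[OF L near[OF S]]
      by (simp add: neg_tangent_curvature_def form_add[OF hp] form_diff[OF hp] tangent_closed)
  qed
  have "h p (Z p) (neg_tangent_curvature X Y T p) =
      h p (Z p) (N p (Y p) (\<lambda>q. N q (X q) T)) - h p (Z p) (N p (X p) (\<lambda>q. N q (Y q) T))
      + h p (Z p) (N p (lie_bracket A X Y p) T)"
    using left[OF T vector_field_tangent[OF Z U(2)]] by (simp only: sym_formsD(1)[OF hp, of "Z p"])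
  moreover have "curvature_on_fields A N X Y h p (Z p) (T p) =
      nabla_W A N p (X p) (\<lambda>q. nabla_W A N q (Y q) h) (Z p) (T p) -
      nabla_W A N p (Y p) (\<lambda>q. nabla_W A N q (X q) h) (Z p) (T p) -
      nabla_W A N p (lie_bracket A X Y p) h (Z p) (T p)"
    by (simp add: curvature_on_fields_def)
  ultimately show ?thesis
    using left[OF Z vector_field_tangent[OF T U(2)]] second[OF X Y] second[OF Y X] L_apply by linarith
qed

end

section \<open>Parallel forms and the derived flag\<close>

context affine_connection
begin

lemma curvature_on_fields_form:
  assumes U: "open U" "p \<in> U" and X: "vector_field A U X" and Y: "vector_field A U Y" and h: "W_section A U h"
  shows "curvature_on_fields A N X Y h p \<in> sym_forms A p"
proof -
  note near = vector_field_nearI[OF U]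
  have "nabla_W A N p (X p) (\<lambda>q. nabla_W A N q (Y q) h) \<in> sym_forms A p"
    by (rule nabla_W_form[OF vector_field_tangent[OF X U(2)] form_nearI[OF U nabla_W_section[OF U(1) Y h]]])
  moreover have "nabla_W A N p (Y p) (\<lambda>q. nabla_W A N q (X q) h) \<in> sym_forms A p"
    by (rule nabla_W_form[OF vector_field_tangent[OF Y U(2)] form_nearI[OF U nabla_W_section[OF U(1) X h]]])
  moreover have "nabla_W A N p (lie_bracket A X Y p) h \<in> sym_forms A p"
    by (rule nabla_W_form[OF lie_bracket_tangent[OF near[OF X] near[OF Y]] form_nearI[OF U h]])
  ultimately show ?thesis
    unfolding curvature_on_fields_def by (intro subspace_diff[OF subspace_sym_forms])
qed

lemma curvature_on_fields_parallel:
  assumes U: "open U" "p \<in> U" and X: "vector_field A U X" and Y: "vector_field A U Y"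
    and g: "parallel_on A N U g"
  shows "curvature_on_fields A N X Y g p = 0"
proof -
  have zero: "nabla_W A N q v g = 0" if "q \<in> U" "v \<in> tangent_space A q" for q v
    using g that unfolding parallel_on_def by blast
  have "nabla_W A N p (X p) (\<lambda>q. nabla_W A N q (Y q) g) = 0"
    by (rule nabla_W_zero[OF vector_field_tangent[OF X U(2)] U]) (simp add: zero vector_field_tangent[OF Y])
  moreover have "nabla_W A N p (Y p) (\<lambda>q. nabla_W A N q (X q) g) = 0"
    by (rule nabla_W_zero[OF vector_field_tangent[OF Y U(2)] U]) (simp add: zero vector_field_tangent[OF X])
  moreover have "nabla_W A N p (lie_bracket A X Y p) g = 0"
    using zero[OF U(2)] lie_bracket_tangent vector_field_nearI[OF U] X Y by blast
  ultimately show ?thesis by (simp add: curvature_on_fields_def)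
qed

lemma curvature_on_fields_pointwise:
  assumes U: "open U" "p \<in> U" and X: "vector_field A U X" and Y: "vector_field A U Y"
    and h: "W_section A U h" and g: "W_section A U g" and eq: "h p = g p"
  shows "curvature_on_fields A N X Y h p = curvature_on_fields A N X Y g p"
proof (rule sym_forms_eqI)
  fix a b assume ab: "a \<in> tangent_space A p" "b \<in> tangent_space A p"
  obtain Z where Z: "vector_field_near A p Z" "Z p = a" using tangent_extend[OF ab(1)] .
  obtain T where T: "vector_field_near A p T" "T p = b" using tangent_extend[OF ab(2)] .
  obtain V where V: "open V" "p \<in> V" "vector_field A V Z" "vector_field A V T"
    using vector_field_near_common[OF Z(1) T(1)] .
  have "curvature_on_fields A N X Y k p (Z p) (T p) =
      k p (neg_tangent_curvature X Y Z p) (T p) + k p (Z p) (neg_tangent_curvature X Y T p)"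
    if k: "W_section A U k" for k
    by (rule curvature_on_fields_apply[of "U \<inter> V"])
       (use U V X Y k in \<open>auto intro: vector_field_subset W_section_subset\<close>)
  from this[OF h] this[OF g]
  show "curvature_on_fields A N X Y h p a b = curvature_on_fields A N X Y g p a b"
    using Z T eq by simp
qed (rule curvature_on_fields_form[OF U X Y]; fact h g)+

text \<open>The curvature tensor is a definite description over all extensions of \<open>a\<close>, \<open>b\<close> and \<open>g p\<close>. All of
  them give \<open>0\<close>, since an extension of \<open>g p\<close> can be exchanged for the parallel form \<open>g\<close>.\<close>

lemma curvature_tensor_parallel:
  assumes U: "open U" "p \<in> U" and g: "W_section A U g" "parallel_on A N U g"
    and a: "a \<in> tangent_space A p" and b: "b \<in> tangent_space A p"
  shows "curvature_tensor A N p a b (g p) = 0"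
  unfolding curvature_tensor_def
proof (rule the_equality)
  have par: "parallel_on A N V g" if "V \<subseteq> U" for V using g(2) that unfolding parallel_on_def by blast
  obtain X where X: "vector_field_near A p X" "X p = a" using tangent_extend[OF a] .
  obtain Y where Y: "vector_field_near A p Y" "Y p = b" using tangent_extend[OF b] .
  obtain V where V: "open V" "p \<in> V" "vector_field A V X" "vector_field A V Y"
    using vector_field_near_common[OF X(1) Y(1)] .
  have UV: "open (U \<inter> V)" "p \<in> U \<inter> V" using U V by auto
  have XY: "vector_field A (U \<inter> V) X" "vector_field A (U \<inter> V) Y"
    using V vector_field_subset by blast+
  have "curvature_on_fields A N X Y g p = 0"
    by (rule curvature_on_fields_parallel[OF UV XY par]) simp
  then show "\<exists>U X Y h. open U \<and> p \<in> U \<and> vector_field A U X \<and> vector_field A U Y \<and> W_section A U h \<and>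
      X p = a \<and> Y p = b \<and> h p = g p \<and> 0 = curvature_on_fields A N X Y h p"
    using UV XY X(2) Y(2) W_section_subset[OF g(1), of "U \<inter> V"]
    by (intro exI[of _ "U \<inter> V"] exI[of _ X] exI[of _ Y] exI[of _ g]) simp
  fix B
  assume "\<exists>U X Y h. open U \<and> p \<in> U \<and> vector_field A U X \<and> vector_field A U Y \<and> W_section A U h \<and>
      X p = a \<and> Y p = b \<and> h p = g p \<and> B = curvature_on_fields A N X Y h p"
  then obtain V X Y h where V: "open V" "p \<in> V" "vector_field A V X" "vector_field A V Y" "W_section A V h"
    "h p = g p" "B = curvature_on_fields A N X Y h p" by blast
  have UV: "open (U \<inter> V)" "p \<in> U \<inter> V" using U V by auto
  have XY: "vector_field A (U \<inter> V) X" "vector_field A (U \<inter> V) Y"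
    using V vector_field_subset by blast+
  have "curvature_on_fields A N X Y h p = curvature_on_fields A N X Y g p"
  proof (rule curvature_on_fields_pointwise[where h=h and g=g, OF UV XY])
    show "W_section A (U \<inter> V) h" "W_section A (U \<inter> V) g"
      using W_section_subset[OF V(5)] W_section_subset[OF g(1)] by auto
  qed (rule V(6))
  also have "\<dots> = 0" by (rule curvature_on_fields_parallel[OF UV XY par]) simp
  finally show "B = 0" using V(7) by simp
qed

lemma section_partI:
  assumes "open U" "p \<in> U" "W_section A U g" "\<And>q. q \<in> U \<Longrightarrow> (q, g q) \<in> V"
  shows "(p, g p) \<in> section_part A V"
  using assms unfolding section_part_def by blast

text \<open>A parallel form survives every step of the derived flag: its curvature vanishes, and at each later
  step \<open>g\<close> itself is a section through \<open>g p\<close> whose derivative represents the zero class.\<close>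

lemma parallel_in_V_flag:
  assumes U: "open U" and g: "W_section A U g" "parallel_on A N U g"
  shows "p \<in> U \<Longrightarrow> (p, g p) \<in> V_flag A N i"
proof (induction i arbitrary: p)
  case 0
  then show ?case
    using W_section_form[OF g(1)] curvature_tensor_parallel[OF U _ g] by (simp add: W_bundle_def)
next
  case (Suc i)
  let ?W = "section_part A (V_flag A N i)"
  have mem: "(q, g q) \<in> ?W" if "q \<in> U" for q
    by (rule section_partI[OF U that g(1) Suc.IH])
  have "nabla_W A N p v g = 0" if "v \<in> tangent_space A p" for v
    using g(2) Suc.prems that unfolding parallel_on_def by blast
  then have "(\<lambda>v\<in>tangent_space A p. fibre ?W p) =
      (\<lambda>v\<in>tangent_space A p. (\<lambda>B. nabla_W A N p v g + B) ` fibre ?W p)"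
    by (intro restrict_ext) simp
  then have "second_fundamental_form A N ?W p (g p) (\<lambda>v\<in>tangent_space A p. fibre ?W p)"
    unfolding second_fundamental_form_def using U Suc.prems g(1) mem by blast
  then show ?case using mem[OF Suc.prems] by (simp add: ker_second_fundamental_form_def)
qed

lemma parallel_in_W_tilde:
  assumes "open U" "p \<in> U" "W_section A U g" "parallel_on A N U g"
  shows "(p, g p) \<in> W_tilde A N"
  unfolding W_tilde_def W_flag_def
  by (rule section_partI[OF assms(1-3) parallel_in_V_flag[OF assms(1,3,4)]])

end

section \<open>Line bundles of forms\<close>

context smooth_atlas
begin

lemma vector_subbundle_basis:
  assumes "vector_subbundle A V"
  obtains U r where "open U" "p \<in> U"
    "\<And>q. q \<in> U \<Longrightarrow> \<exists>B. independent B \<and> card B = r \<and> span B = fibre V q"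
proof -
  from assms have "\<forall>p. \<exists>U r e. open U \<and> p \<in> U \<and> (\<forall>i<r. W_section A U (e i)) \<and>
      (\<forall>q\<in>U. inj_on (\<lambda>i. e i q) {..<(r::nat)} \<and> independent ((\<lambda>i. e i q) ` {..<r}) \<and>
        span ((\<lambda>i. e i q) ` {..<r}) = fibre V q)"
    unfolding vector_subbundle_def by (elim conjE)
  from spec[OF this, of p] show thesis
  proof (elim exE conjE)
    fix U r and e :: "nat \<Rightarrow> 'm \<Rightarrow> 'm form"
    assume U: "open U" "p \<in> U"
      and e: "\<forall>q\<in>U. inj_on (\<lambda>i. e i q) {..<r} \<and> independent ((\<lambda>i. e i q) ` {..<r}) \<and>
        span ((\<lambda>i. e i q) ` {..<r}) = fibre V q"
    show thesis
    proof (rule that[OF U])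
      fix q assume "q \<in> U"
      then show "\<exists>B. independent B \<and> card B = r \<and> span B = fibre V q"
        using bspec[OF e, of q] by (intro exI[of _ "(\<lambda>i. e i q) ` {..<r}"]) (simp add: card_image)
    qed
  qed
qed

text \<open>The rank is locally constant and the manifold is connected. This is what makes the definite description
  in \<open>bundle_rank\<close> meaningful.\<close>

lemma vector_subbundle_dim_const:
  assumes "vector_subbundle A V"
  shows "dim (fibre V p) = dim (fibre V q)"
proof (rule connected_local_const[where A=UNIV and f="\<lambda>p. dim (fibre V p)"])
  show "connected (UNIV :: 'm set)" using manifold unfolding connected_smooth_manifold_def by blast
  show "\<forall>a\<in>UNIV. \<forall>\<^sub>F b in at a. dim (fibre V a) = dim (fibre V b)"
  proof
    fix a
    obtain U r where U: "open U" "a \<in> U"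
      "\<And>q. q \<in> U \<Longrightarrow> \<exists>B. independent B \<and> card B = r \<and> span B = fibre V q"
      using vector_subbundle_basis[OF assms] by metis
    have "dim (fibre V q) = r" if "q \<in> U" for q
      using U(3)[OF that] dim_span_eq_card_independent by metis
    then have "\<forall>b\<in>U. dim (fibre V a) = dim (fibre V b)" using U(2) by simp
    then show "\<forall>\<^sub>F b in at a. dim (fibre V a) = dim (fibre V b)"
      using U(1,2) unfolding eventually_at_topological by blast
  qed
qed simp_all

lemma bundle_rank_dim:
  assumes "vector_subbundle A V"
  shows "dim (fibre V p) = bundle_rank V"
proof -
  have const: "dim (fibre V q) = dim (fibre V p)" for q by (rule vector_subbundle_dim_const[OF assms])
  have "bundle_rank V = dim (fibre V p)"
    unfolding bundle_rank_def
  proof (rule the_equality)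
    show "\<forall>q. dim (fibre V q) = dim (fibre V p)" using const by blast
  qed simp
  then show ?thesis by simp
qed

lemma rank_one_multiple:
  assumes V: "vector_subbundle A V" "bundle_rank V = 1"
    and w: "w \<in> fibre V p" "w \<noteq> 0" and w': "w' \<in> fibre V p"
  obtains a where "w' = a *\<^sub>R w"
proof -
  obtain B where B: "independent B" "span B = fibre V p"
    using vector_subbundle_basis[OF V(1)] by metis
  have "card B = 1" using dim_span_eq_card_independent[OF B(1)] B(2) bundle_rank_dim[OF V(1)] V(2) by simp
  then obtain b where "B = {b}" by (auto simp: card_1_singleton_iff)
  then have "fibre V p = range (\<lambda>k. k *\<^sub>R b)" using B(2) span_singleton by metis
  then obtain k k' where k: "w = k *\<^sub>R b" "w' = k' *\<^sub>R b" using w(1) w' by blast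
  then have "w' = (k' / k) *\<^sub>R w" using w(2) by auto
  then show thesis by (rule that)
qed

section \<open>Exact one-forms\<close>

lemma one_form_zero: "is_one_form A 0"
  unfolding is_one_form_def by (simp add: smooth_fun_const)

lemma closed_zero: "closed_one_form A 0"
  unfolding closed_one_form_def using one_form_zero
  by (simp add: tangent_const[OF vector_field_tangent])

lemma one_form_diff:
  assumes "is_one_form A \<Phi>" "is_one_form A \<Psi>"
  shows "is_one_form A (\<Phi> - \<Psi>)"
  using assms unfolding is_one_form_def by (auto simp: algebra_simps intro: smooth_fun_diff)

text \<open>Differences suffice: \<open>0 - \<Psi> = (\<Phi> - \<Psi>) - \<Phi>\<close> passes from the class of an exact \<open>\<Phi>\<close> to that of \<open>0\<close>.\<close>

lemma exact_diff:
  assumes "exact_one_form A \<Phi>" "exact_one_form A \<Psi>"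
  shows "exact_one_form A (\<Phi> - \<Psi>)"
proof -
  obtain f where f: "smooth_fun A UNIV f" "\<And>p v. v \<in> tangent_space A p \<Longrightarrow> \<Phi> p v = v f"
    using assms(1) unfolding exact_one_form_def by blast
  obtain g where g: "smooth_fun A UNIV g" "\<And>p v. v \<in> tangent_space A p \<Longrightarrow> \<Psi> p v = v g"
    using assms(2) unfolding exact_one_form_def by blast
  have "(\<Phi> - \<Psi>) p v = v (\<lambda>q. f q - g q)" if v: "v \<in> tangent_space A p" for p v
    using tangent_diff[OF v smooth_nearI[OF open_UNIV UNIV_I f(1)] smooth_nearI[OF open_UNIV UNIV_I g(1)]]
      f(2)[OF v] g(2)[OF v] by simp
  moreover have "smooth_fun A UNIV (\<lambda>q. f q - g q)" using smooth_fun_diff[OF open_UNIV f(1) g(1)] .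
  moreover have "is_one_form A (\<Phi> - \<Psi>)" using assms one_form_diff unfolding exact_one_form_def by blast
  ultimately show ?thesis unfolding exact_one_form_def by blast
qed

end

section \<open>Metrics that are parallel up to a one-form\<close>

context affine_connection
begin

text \<open>If \<open>s = c g\<close> with \<open>g\<close> parallel, then \<open>\<nabla>s = dc \<otimes> g\<close>, so \<open>\<Phi> = d (ln c)\<close>. Evaluating both forms on
  a coordinate field \<open>X\<close> shows that \<open>ln c = ln (s(X, X)) - ln (g(X, X))\<close> is smooth.\<close>

lemma exact_of_parallel_multiple:
  assumes g: "metric_on A UNIV g" "parallel_on A N UNIV g"
    and s: "metric_on A UNIV s" "\<And>p v. v \<in> tangent_space A p \<Longrightarrow> nabla_W A N p v s = \<Phi> p v *\<^sub>R s p"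
    and mult: "\<And>p. \<exists>a. s p = a *\<^sub>R g p" and \<Phi>: "is_one_form A \<Phi>"
  shows "exact_one_form A \<Phi>"
proof -
  have gW: "W_section A UNIV g" and sW: "W_section A UNIV s" using g s unfolding metric_on_def by auto
  have pos: "g p v v > 0" "s p v v > 0" if "v \<in> tangent_space A p" "v \<noteq> 0" for p v
    using g(1) s(1) that unfolding metric_on_def pos_def_def by auto
  define a where "a = (\<lambda>p. SOME a. s p = a *\<^sub>R g p)"
  have a: "s p = a p *\<^sub>R g p" for p unfolding a_def by (rule someI_ex[OF mult])
  define F where "F = (\<lambda>p. ln (a p))"
  obtain i :: 'e where i: "i \<in> Basis" using nonempty_Basis by blast
  have local: "smooth_fun A (fst c) F \<and> (\<forall>p\<in>fst c. \<forall>v\<in>tangent_space A p. v F = \<Phi> p v)" if c: "c \<in> A" for c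
  proof -
    let ?U = "fst c"
    define X where "X = (\<lambda>q. coord_vec A c q i)"
    define G where "G = (\<lambda>q. g q (X q) (X q))"
    define S where "S = (\<lambda>q. s q (X q) (X q))"
    have U: "open ?U" using open_chart[OF c] .
    have X: "vector_field A ?U X" unfolding X_def using coord_field[OF c] .
    have Gpos: "G q > 0" and Spos: "S q > 0" if "q \<in> ?U" for q
      unfolding G_def S_def
      using pos[OF vector_field_tangent[OF X that]] coord_vec_nonzero[OF c that i] by (auto simp: X_def)
    have SG: "S q = a q * G q" for q
      using fun_cong[OF fun_cong[OF a[of q]]] by (simp add: S_def G_def form_scaleR_apply)
    have F: "F q = ln (S q) - ln (G q)" if "q \<in> ?U" for q
    proof -
      have "a q > 0" using SG[of q] Spos[OF that] Gpos[OF that] by (simp add: zero_less_mult_iff)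
      then show ?thesis using Gpos[OF that] by (simp add: F_def SG ln_mult)
    qed
    have smG: "smooth_fun A ?U G" unfolding G_def by (rule W_section_smooth[OF gW U _ X X]) simp
    have smS: "smooth_fun A ?U S" unfolding S_def by (rule W_section_smooth[OF sW U _ X X]) simp
    have lnG: "smooth_fun A ?U (\<lambda>q. ln (G q))"
      by (rule smooth_fun_compose[OF U smG smooth_on_ln open_greaterThan]) (use Gpos in auto)
    have lnS: "smooth_fun A ?U (\<lambda>q. ln (S q))"
      by (rule smooth_fun_compose[OF U smS smooth_on_ln open_greaterThan]) (use Spos in auto)
    have "smooth_fun A ?U F"
      by (rule smooth_fun_cong[OF U _ smooth_fun_diff[OF U lnS lnG]]) (simp add: F)
    moreover have "v F = \<Phi> p v" if p: "p \<in> ?U" and v: "v \<in> tangent_space A p" for p v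
    proof -
      note near = smooth_nearI[OF U p]
      note Xn = vector_field_nearI[OF U p X]
      have "v F = v (\<lambda>q. ln (S q) - ln (G q))" by (rule tangent_cong[OF v U p F])
      also have "\<dots> = v (\<lambda>q. ln (S q)) - v (\<lambda>q. ln (G q))"
        by (rule tangent_diff[OF v near[OF lnS] near[OF lnG]])
      also have "\<dots> = inverse (S p) * v S - inverse (G p) * v G"
        using tangent_compose[OF v near[OF smS] near[OF lnS] DERIV_ln[OF Spos[OF p]]]
          tangent_compose[OF v near[OF smG] near[OF lnG] DERIV_ln[OF Gpos[OF p]]] by simp
      also have "v G = g p (N p v X) (X p) + g p (X p) (N p v X)"
      proof -
        have "nabla_W A N p v g = 0" using g(2) v unfolding parallel_on_def by blast
        then show ?thesis
          using nabla_W_apply[OF v form_nearI[OF open_UNIV UNIV_I gW] Xn Xn] by (simp add: G_def)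
      qed
      also have "v S = \<Phi> p v * S p + a p * (g p (N p v X) (X p) + g p (X p) (N p v X))"
      proof -
        have "\<Phi> p v * S p = v S - s p (N p v X) (X p) - s p (X p) (N p v X)"
          using nabla_W_apply[OF v form_nearI[OF open_UNIV UNIV_I sW] Xn Xn]
          by (simp add: S_def s(2)[OF v] form_scaleR_apply)
        then show ?thesis by (simp add: a[of p] form_scaleR_apply algebra_simps)
      qed
      finally have "v F = inverse (a p * G p) * (\<Phi> p v * (a p * G p) +
          a p * (g p (N p v X) (X p) + g p (X p) (N p v X))) -
          inverse (G p) * (g p (N p v X) (X p) + g p (X p) (N p v X))"
        unfolding SG .
      moreover have "a p \<noteq> 0" "G p \<noteq> 0" using Spos[OF p] unfolding SG by auto
      ultimately show ?thesis by (simp add: field_simps)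
    qed
    ultimately show ?thesis by blast
  qed
  have "smooth_fun A UNIV F"
  proof (rule smooth_fun_local)
    fix p
    obtain c where "c \<in> A" "p \<in> fst c" by (rule chart_at)
    then show "\<exists>T. open T \<and> p \<in> T \<and> smooth_fun A T F" using local open_chart by blast
  qed
  moreover have "\<Phi> p v = v F" if "v \<in> tangent_space A p" for p v
  proof -
    obtain c where "c \<in> A" "p \<in> fst c" by (rule chart_at)
    then show ?thesis using local that by simp
  qed
  ultimately show ?thesis using \<Phi> unfolding exact_one_form_def by blast
qed

text \<open>The derivative \<open>- exp (- f) df\<close> of the factor cancels \<open>\<nabla>s = df \<otimes> s\<close> in \<open>exp (- f) s\<close>.\<close>

lemma parallel_rescaling:
  assumes s: "metric_on A UNIV s" "\<And>p v. v \<in> tangent_space A p \<Longrightarrow> nabla_W A N p v s = v f *\<^sub>R s p"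
    and f: "smooth_fun A UNIV f"
  shows "metric_connection A N"
proof -
  let ?a = "\<lambda>q. exp (- 1 * f q)"
  have sW: "W_section A UNIV s" using s unfolding metric_on_def by auto
  have neg: "smooth_fun A UNIV (\<lambda>q. - 1 * f q)" by (rule smooth_fun_mult[OF open_UNIV smooth_fun_const f])
  have a: "smooth_fun A UNIV ?a"
    by (rule smooth_fun_compose[OF open_UNIV neg smooth_on_exp open_UNIV subset_UNIV])
  note near = smooth_nearI[OF open_UNIV UNIV_I]
  have "nabla_W A N p v (\<lambda>q. ?a q *\<^sub>R s q) = 0" if v: "v \<in> tangent_space A p" for p v
  proof -
    have "v ?a = exp (- 1 * f p) * v (\<lambda>q. - 1 * f q)"
      by (rule tangent_compose[OF v near[OF neg] near[OF a] DERIV_exp])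
    also have "v (\<lambda>q. - 1 * f q) = - 1 * v f" by (rule tangent_cmult[OF v near[OF f]])
    finally show ?thesis
      using nabla_W_scale[OF v near[OF a] form_nearI[OF open_UNIV UNIV_I sW]] s(2)[OF v] by simp
  qed
  then have "parallel_on A N UNIV (\<lambda>q. ?a q *\<^sub>R s q)" unfolding parallel_on_def by blast
  moreover have "metric_on A UNIV (\<lambda>q. ?a q *\<^sub>R s q)"
    using W_section_scale[OF sW a] s(1) unfolding metric_on_def pos_def_def
    by (auto simp: form_scaleR_apply)
  ultimately show ?thesis unfolding metric_connection_def by blast
qed

end

theorem theorem5:
  fixes A :: "('m::{t2_space, second_countable_topology}, 'e::euclidean_space) chart set"
    and N :: "'m covariant_derivative"
  assumes "connected_smooth_manifold A"
    and "is_connection A N"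
    and "regular_connection A N"
    and "locally_metric A N"
    and "bundle_rank (W_tilde A N) = 1"
  shows "metric_connection A N \<longleftrightarrow> connection_class A N = de_rham_class A 0"
proof -
  interpret affine_connection A N using assms(1,2) by unfold_locales
  show ?thesis
  proof
    assume "metric_connection A N"
    then obtain g where g: "metric_on A UNIV g" "parallel_on A N UNIV g"
      unfolding metric_connection_def by blast
    then have gW: "W_section A UNIV g" and gpos: "\<And>p. pos_def A p (g p)" unfolding metric_on_def by auto
    have gt: "(p, g p) \<in> W_tilde A N" for p by (rule parallel_in_W_tilde[OF open_UNIV UNIV_I gW g(2)])
    have exact: "exact_one_form A \<Phi>"
      if s: "W_section A UNIV s" "\<And>p. (p, s p) \<in> W_tilde_pos A N" and \<Phi>: "is_one_form A \<Phi>"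
        "\<And>p v. v \<in> tangent_space A p \<Longrightarrow> nabla_W A N p v s = \<Phi> p v *\<^sub>R s p" for s \<Phi>
    proof (rule exact_of_parallel_multiple[OF g _ \<Phi>(2) _ \<Phi>(1)])
      show "metric_on A UNIV s" using s unfolding metric_on_def W_tilde_pos_def by auto
      fix p
      obtain c where c: "c \<in> A" "p \<in> fst c" by (rule chart_at)
      obtain i :: 'e where i: "i \<in> Basis" using nonempty_Basis by blast
      have "g p (coord_vec A c p i) (coord_vec A c p i) > 0"
        using gpos coord_vec_tangent[OF c] coord_vec_nonzero[OF c i] unfolding pos_def_def by blast
      then have "g p \<noteq> 0" by auto
      moreover have "g p \<in> fibre (W_tilde A N) p" "s p \<in> fibre (W_tilde A N) p"
        using gt s(2) by (simp_all add: fibre_def W_tilde_pos_def)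
      moreover have "vector_subbundle A (W_tilde A N)" using assms(3) by (simp add: regular_connection_def)
      ultimately show "\<exists>a. s p = a *\<^sub>R g p" using rank_one_multiple[OF _ assms(5)] by metis
    qed
    show "connection_class A N = de_rham_class A 0"
    proof
      have "nabla_W A N p v g = (0 :: 'm one_form) p v *\<^sub>R g p" if "v \<in> tangent_space A p" for p v
        using g(2) that by (simp add: parallel_on_def)
      moreover have "(p, g p) \<in> W_tilde_pos A N" for p using gt gpos by (simp add: W_tilde_pos_def)
      ultimately show "de_rham_class A 0 \<subseteq> connection_class A N"
        unfolding connection_class_def
        by (intro subsetI UN_I[of "(g, 0)"]) (simp_all add: gW one_form_zero)
      show "connection_class A N \<subseteq> de_rham_class A 0"
      proof
        fix \<Psi> assume "\<Psi> \<in> connection_class A N"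
        then obtain s \<Phi> where s: "W_section A UNIV s" "\<And>p. (p, s p) \<in> W_tilde_pos A N" and
          \<Phi>: "is_one_form A \<Phi>" "\<And>p v. v \<in> tangent_space A p \<Longrightarrow> nabla_W A N p v s = \<Phi> p v *\<^sub>R s p"
          and \<Psi>: "\<Psi> \<in> de_rham_class A \<Phi>"
          unfolding connection_class_def by blast
        have "exact_one_form A (\<Phi> - \<Psi> - \<Phi>)"
          by (rule exact_diff[OF _ exact[OF s \<Phi>]])
             (use \<Psi> in \<open>simp add: de_rham_class_def cohomologous_def\<close>)
        then show "\<Psi> \<in> de_rham_class A 0"
          using \<Psi> closed_zero by (simp add: de_rham_class_def cohomologous_def)
      qed
    qed
  next
    \<comment> \<open>The class of \<open>0\<close> is not empty, which is where a positive section comes from.\<close>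
    assume eq: "connection_class A N = de_rham_class A 0"
    have "exact_one_form A 0"
      unfolding exact_one_form_def using one_form_zero smooth_fun_const tangent_const by fastforce
    then have "0 \<in> connection_class A N"
      unfolding eq using closed_zero by (simp add: de_rham_class_def cohomologous_def)
    then obtain s \<Phi> where s: "W_section A UNIV s" "\<And>p. (p, s p) \<in> W_tilde_pos A N" and
      \<Phi>: "\<And>p v. v \<in> tangent_space A p \<Longrightarrow> nabla_W A N p v s = \<Phi> p v *\<^sub>R s p"
      and cls: "0 \<in> de_rham_class A \<Phi>"
      unfolding connection_class_def by blast
    obtain f where f: "smooth_fun A UNIV f" "\<And>p v. v \<in> tangent_space A p \<Longrightarrow> \<Phi> p v = v f"
      using cls unfolding de_rham_class_def cohomologous_def exact_one_form_def by auto
    show "metric_connection A N"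
    proof (rule parallel_rescaling[OF _ _ f(1)])
      show "metric_on A UNIV s" using s unfolding metric_on_def W_tilde_pos_def by auto
      show "nabla_W A N p v s = v f *\<^sub>R s p" if "v \<in> tangent_space A p" for p v
        using \<Phi>[OF that] f(2)[OF that] by simp
    qed
  qed
qed

end
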